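(* Let $\xi_0\in\mathbb{R}^n$ and let $\xi\colon[0,\infty)\to\mathbb{R}^n$ solve $\xi'(t)=r(\xi(t))$, $\xi(0)=\xi_0$. Then $\operatorname{dist}(\xi(t),\tilde W)\to0$ as $t\to\infty$, where $$\tilde W:=\{\tilde\xi_0\in\mathbb{R}^n : \bar u:=\tilde u(\tilde\xi_0)\text{ satisfies (OC)}\},$$ $$(\mathrm{OC})\qquad -\tfrac2\alpha g'(\bar u)\in\Big\{\psi\in C(F):\int_D\psi^c\,\mathrm{d}u_d+\int_F\psi\,\mathrm{d}\bar u=W_2^2(u_d,\bar u)\Big\}.$$ If all roots of $r$ are isolated, then $\xi(t)$ converges to a root of $r$ as $t\to\infty$.
   Context: $|\cdot|$ is the Euclidean norm. $F=\{a_1,\ldots,a_n\}\subset\mathbb{R}^2$ is a finite set of pairwise distinct points; $D\subset\mathbb{R}^2$ is a convex compact polygon with nonempty interior; $u_d$ is a nonnegative Borel measure on $D$, absolutely continuous w.r.t. the Lebesgue measure, with density $\varrho$ continuous on $D$; $\alpha>0$. $\mathcal{M}(F)$ (signed Borel measures on $F$) is identified with $\mathbb{R}^n$ via $v\leftrightarrow\sum_{i=1}^n v_i\delta_{a_i}$. $g\colon\mathcal{M}(F)\cong\mathbb{R}^n\to\mathbb{R}$ is twice continuously differentiable with gradient $\nabla g$; $g'(u)$ is identified with the function in $C(F)$ whose value at $a_i$ is the $i$-th component of $\nabla g(u)$. For $u\in\mathcal{M}(F)$, $W_2^2(u_d,u):=\inf\{\int_{D\times F}|x_1-x_2|^2\,\mathrm{d}\gamma(x_1,x_2)\}$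 over all nonnegative Borel measures $\gamma$ on $D\times F$ with marginals $u_d$ and $u$ ($+\infty$ if there are none). For $\psi\in C(F)$, $\psi^c(x):=\inf\{c(x,a_i)-\psi(a_i):i=1,\ldots,n\}$ for $x\in\mathbb{R}^2$, with $c(x_1,x_2)=|x_1-x_2|^2$. For $\xi\in\mathbb{R}^n$: $D_i(\xi):=\{x\in\operatorname{int}(D): a_i^\top x-\xi_i>a_j^\top x-\xi_j\ \forall j\ne i\}$; $\tilde u(\xi):=(u_d(D_1(\xi)),\ldots,u_d(D_n(\xi)))^\top\in\mathbb{R}^n\cong\mathcal{M}(F)$; $A:=\frac12(|a_1|^2,\ldots,|a_n|^2)^\top$; $r(\xi):=A+\frac1\alpha\nabla g(\tilde u(\xi))-\xi$. *)

theory Defs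
  imports "HOL-Analysis.Analysis"
begin

text \<open>
  The points are given by an injective family \<open>a :: 'n \<Rightarrow> real^2\<close> over a finite (nonempty) index
  type, so \<open>F = range a\<close>, and a vector \<open>v :: real^'n\<close> stands for the signed measure
  \<open>\<Sum>i. v $ i * \<delta>(a i)\<close> on \<open>F\<close>.
\<close>

definition signed_meas :: "('n::finite \<Rightarrow> real^2) \<Rightarrow> real^'n \<Rightarrow> (real^2) set \<Rightarrow> real" where
  "signed_meas a v E = (\<Sum>i\<in>UNIV. v $ i * indicator E (a i))"

definition integral_signed :: "('n::finite \<Rightarrow> real^2) \<Rightarrow> real^'n \<Rightarrow> (real^2 \<Rightarrow> real) \<Rightarrow> real" where
  "integral_signed a v \<psi> = (\<Sum>i\<in>UNIV. \<psi> (a i) * v $ i)"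

text \<open>
  The second marginal is compared in \<open>ereal\<close>: \<open>ennreal\<close> would clip negative weights of \<open>u\<close> to 0,
  whereas a signed \<open>u\<close> with a negative weight must have no couplings at all.
\<close>

definition couplings ::
  "(real^2) set \<Rightarrow> (real^2) measure \<Rightarrow> ('n::finite \<Rightarrow> real^2) \<Rightarrow> real^'n \<Rightarrow> ((real^2) \<times> (real^2)) measure set"
where
  "couplings D ud a u =
     {\<gamma>. sets \<gamma> = sets (restrict_space borel (D \<times> range a)) \<and>
         (\<forall>B\<in>sets (restrict_space borel D). emeasure \<gamma> (B \<times> range a) = emeasure ud B) \<and>
         (\<forall>E\<subseteq>range a. enn2ereal (emeasure \<gamma> (D \<times> E)) = ereal (signed_meas a u E))}"

definition cost :: "real^2 \<Rightarrow> real^2 \<Rightarrow> real" where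
  "cost x y = (norm (x - y))\<^sup>2"

text \<open>The infimum over the empty set of couplings is \<open>\<infinity>\<close>.\<close>

definition W22 ::
  "(real^2) set \<Rightarrow> (real^2) measure \<Rightarrow> ('n::finite \<Rightarrow> real^2) \<Rightarrow> real^'n \<Rightarrow> ereal" where
  "W22 D ud a u =
     enn2ereal (INF \<gamma>\<in>couplings D ud a u. \<integral>\<^sup>+ p. ennreal (cost (fst p) (snd p)) \<partial>\<gamma>)"

definition c_transform :: "('n::finite \<Rightarrow> real^2) \<Rightarrow> (real^2 \<Rightarrow> real) \<Rightarrow> real^2 \<Rightarrow> real" where
  "c_transform a \<psi> x = (INF i. cost x (a i) - \<psi> (a i))"

text \<open>
  Elements of \<open>C(F)\<close> are represented by functions on the whole plane that are continuous on \<open>F\<close>;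
  only their values on \<open>F\<close> enter the definitions.
\<close>

definition potentials ::
  "(real^2) set \<Rightarrow> (real^2) measure \<Rightarrow> ('n::finite \<Rightarrow> real^2) \<Rightarrow> real^'n \<Rightarrow> (real^2 \<Rightarrow> real) set" where
  "potentials D ud a u =
     {\<psi>. continuous_on (range a) \<psi> \<and>
         ereal ((\<integral>x. c_transform a \<psi> x \<partial>ud) + integral_signed a u \<psi>) = W22 D ud a u}"

text \<open>The function on \<open>F\<close> with value \<open>v $ i\<close> at \<open>a i\<close> (for injective \<open>a\<close>).\<close>

definition fun_of_vec :: "('n::finite \<Rightarrow> real^2) \<Rightarrow> real^'n \<Rightarrow> real^2 \<Rightarrow> real" where
  "fun_of_vec a v x = v $ (inv a x)"

definition cell ::
  "(real^2) set \<Rightarrow> ('n::finite \<Rightarrow> real^2) \<Rightarrow> real^'n \<Rightarrow> 'n \<Rightarrow> (real^2) set" where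
  "cell D a \<xi> i = {x \<in> interior D. \<forall>j. j \<noteq> i \<longrightarrow> a i \<bullet> x - \<xi> $ i > a j \<bullet> x - \<xi> $ j}"

definition u_tilde ::
  "(real^2) set \<Rightarrow> (real^2) measure \<Rightarrow> ('n::finite \<Rightarrow> real^2) \<Rightarrow> real^'n \<Rightarrow> real^'n" where
  "u_tilde D ud a \<xi> = (\<chi> i. measure ud (cell D a \<xi> i))"

definition OC ::
  "(real^2) set \<Rightarrow> (real^2) measure \<Rightarrow> ('n::finite \<Rightarrow> real^2) \<Rightarrow> real \<Rightarrow> (real^'n \<Rightarrow> real^'n)
    \<Rightarrow> real^'n \<Rightarrow> bool" where
  "OC D ud a \<alpha> gradg u \<longleftrightarrow>
     (\<lambda>x. - (2 / \<alpha>) * fun_of_vec a (gradg u) x) \<in> potentials D ud a u"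

text \<open>
  With the convention that the distance to the empty set is \<open>\<infinity>\<close>, distances tending to 0 entail
  that the set is nonempty; as \<open>infdist x {} = 0\<close>, nonemptiness has to be stated separately.
\<close>

definition W_tilde ::
  "(real^2) set \<Rightarrow> (real^2) measure \<Rightarrow> ('n::finite \<Rightarrow> real^2) \<Rightarrow> real \<Rightarrow> (real^'n \<Rightarrow> real^'n)
    \<Rightarrow> (real^'n) set" where
  "W_tilde D ud a \<alpha> gradg = {\<xi>. OC D ud a \<alpha> gradg (u_tilde D ud a \<xi>)}"

definition residual ::
  "(real^2) set \<Rightarrow> (real^2) measure \<Rightarrow> ('n::finite \<Rightarrow> real^2) \<Rightarrow> real \<Rightarrow> (real^'n \<Rightarrow> real^'n)
    \<Rightarrow> real^'n \<Rightarrow> real^'n" where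
  "residual D ud a \<alpha> gradg \<xi> =
     (1 / 2) *\<^sub>R (\<chi> i. (norm (a i))\<^sup>2) + (1 / \<alpha>) *\<^sub>R gradg (u_tilde D ud a \<xi>) - \<xi>"

end

theory Submission
  imports Defs
begin

text \<open>
  Write \<open>A\<close> for the vector with entries \<open>|a i|\<^sup>2 / 2\<close>, \<open>U \<xi>\<close> for the masses of the cells and
  \<open>T \<xi> = A + \<nabla>g(U \<xi>) / \<alpha>\<close>. The equation reads \<open>\<xi>' = T \<xi> - \<xi>\<close>: the curve relaxes towards a moving
  target that depends on \<open>\<xi>\<close> only through the cell masses.

  The masses are the negative gradient of the convex function
  \<open>\<Phi> \<xi> = \<integral> (MAX i. a i \<bullet> x - \<xi> i) du\<^sub>d\<close>, so that \<open>G(U \<xi>) - \<xi> \<bullet> U \<xi> - \<Phi> \<xi>\<close> with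
  \<open>G u = A \<bullet> u + g u / \<alpha>\<close> formally has the derivative \<open>\<xi>' \<bullet> (U \<xi>)'\<close> along the curve, which is
  nonpositive because \<open>U\<close> is antitone. The map \<open>U\<close> need not be differentiable (an interface of two
  cells can come to lie along an edge of \<open>D\<close>), so its cocoercivity
  \<open>c |U \<eta> - U \<xi>|\<^sup>2 \<le> - (U \<eta> - U \<xi>) \<bullet> (\<eta> - \<xi>)\<close> takes the place of a chain rule. It holds because the
  mass that moves from cell \<open>i\<close> to cell \<open>j\<close> lies in a strip whose width is proportional to the
  increase of \<open>\<xi> i - \<xi> j\<close> (\<open>moved_bound\<close>, \<open>U_cocoercive\<close>). It yields the
  dissipation inequality \<open>c |U(\<xi> t) - U(\<xi> s)|\<^sup>2 / (t - s) \<le> E(\<xi> s) - E(\<xi> t)\<close> for the energy \<open>E\<close>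
  (\<open>dissipation\<close>).

  As the energy converges, \<open>U(\<xi> t)\<close> and hence the target vary less and less over time windows of a
  fixed length. Over a long window the curve therefore comes close to its target while the cell masses
  hardly change, that is, \<open>U(T(\<xi> t)) - U(\<xi> t) \<longlonglongrightarrow> 0\<close> (\<open>U_target_minus_U_tendsto_0\<close>). Both claims
  follow from this limit by compactness.

  \<^item> A zero \<open>z\<close> of \<open>U \<circ> T - U\<close> lies in \<open>W_tilde\<close>: the vector \<open>\<eta> = T z\<close> has the cell masses \<open>U z\<close>, and
    for every \<open>\<eta>\<close> the function with values \<open>|a i|\<^sup>2 - 2 \<eta> i\<close> is an optimal potential for the masses
    \<open>U \<eta>\<close>, since the map that sends each cell of \<open>\<eta>\<close> to its point attains the dual bound
    (\<open>potential_of_cells\<close>). For \<open>\<eta> = T z\<close> these values are those of \<open>- (2 / \<alpha>) g'\<close>.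

  \<^item> The target \<open>y = T \<circ> \<xi>\<close> satisfies \<open>T y - y \<longlonglongrightarrow> 0\<close>. Its omega-limit set is connected and
    consists of roots of the residual; if these are isolated, it is a single point, \<open>y\<close>
    converges to it, and \<open>\<xi>\<close> follows \<open>y\<close>.
\<close>

section \<open>Omega-limit sets of bounded curves\<close>

definition omega_limit :: "(real \<Rightarrow> 'a::topological_space) \<Rightarrow> 'a set" where
  "omega_limit f = (\<Inter>n::nat. closure (f ` {real n..}))"

lemma compact_closure_tail:
  fixes f :: "real \<Rightarrow> 'a::euclidean_space"
  assumes "bounded (f ` {0..})"
  shows "compact (closure (f ` {real n..}))"
proof -
  have "f ` {real n..} \<subseteq> f ` {0..}" by (intro image_mono) auto
  then show ?thesis using assms bounded_subset by (auto simp: compact_closure)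
qed

lemma closure_tail_antimono: "m \<le> n \<Longrightarrow> closure (f ` {real n..}) \<subseteq> closure (f ` {real m..})"
  by (intro closure_mono image_mono) auto

lemma omega_limit_nonempty:
  fixes f :: "real \<Rightarrow> 'a::euclidean_space"
  assumes "bounded (f ` {0..})"
  shows "omega_limit f \<noteq> {}"
  unfolding omega_limit_def
proof (rule compact_nest)
  show "compact (closure (f ` {real n..}))" for n by (rule compact_closure_tail[OF assms])
qed (use closure_tail_antimono in auto)

lemma connected_omega_limit:
  fixes f :: "real \<Rightarrow> 'a::euclidean_space"
  assumes "bounded (f ` {0..})" "continuous_on {0..} f"
  shows "connected (omega_limit f)"
  unfolding omega_limit_def
proof (rule connected_nest)
  fix n :: nat
  have "continuous_on {real n..} f" using assms(2) by (rule continuous_on_subset) auto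
  then show "connected (closure (f ` {real n..}))"
    by (intro connected_imp_connected_closure connected_continuous_image) auto
  show "compact (closure (f ` {real n..}))" by (rule compact_closure_tail[OF assms(1)])
qed (rule closure_tail_antimono)

text \<open>
  Otherwise the nested compact sets \<open>closure (f ` {n..}) - V\<close> would all be nonempty, and a common
  point would be an omega-limit point outside \<open>V\<close>.
\<close>

lemma omega_limit_attracts:
  fixes f :: "real \<Rightarrow> 'a::euclidean_space"
  assumes "bounded (f ` {0..})" "open V" "omega_limit f \<subseteq> V"
  shows "\<forall>\<^sub>F t in at_top. f t \<in> V"
proof -
  have "\<exists>n::nat. closure (f ` {real n..}) - V = {}"
  proof (rule ccontr)
    assume ne: "\<not> ?thesis"
    have "(\<Inter>n::nat. closure (f ` {real n..}) - V) \<noteq> {}"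
    proof (rule compact_nest)
      show "compact (closure (f ` {real n..}) - V)" for n
        using compact_closure_tail[OF assms(1)] assms(2) by (rule compact_diff)
      show "closure (f ` {real n..}) - V \<subseteq> closure (f ` {real m..}) - V" if "m \<le> n" for m n
        using closure_tail_antimono[OF that, of f] by blast
    qed (use ne in auto)
    with assms(3) show False by (auto simp: omega_limit_def)
  qed
  then obtain n :: nat where n: "closure (f ` {real n..}) \<subseteq> V" by blast
  have "f t \<in> V" if "t \<ge> real n" for t
    using that n closure_subset[of "f ` {real n..}"] by auto
  then show ?thesis by (auto simp: eventually_at_top_linorder)
qed

lemma omega_limit_zero:
  fixes f :: "real \<Rightarrow> 'a::euclidean_space" and F :: "'a \<Rightarrow> 'b::real_normed_vector"
  assumes F: "continuous_on UNIV F" and lim: "((\<lambda>t. F (f t)) \<longlongrightarrow> 0) at_top"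
    and p: "p \<in> omega_limit f"
  shows "F p = 0"
proof -
  have "norm (F p) \<le> e" if "e > 0" for e
  proof -
    have "\<forall>\<^sub>F t in at_top. norm (F (f t)) \<le> e"
      using tendstoD[OF lim that] by (auto elim: eventually_mono)
    then obtain N where N: "\<And>t. t \<ge> N \<Longrightarrow> norm (F (f t)) \<le> e"
      by (auto simp: eventually_at_top_linorder)
    obtain n :: nat where n: "N \<le> real n" using real_arch_simple by blast
    have "closed {x. norm (F x) \<le> e}"
      using F by (intro closed_Collect_le continuous_intros)
    moreover have "f ` {real n..} \<subseteq> {x. norm (F x) \<le> e}" using N n by auto
    ultimately have "closure (f ` {real n..}) \<subseteq> {x. norm (F x) \<le> e}" by (rule closure_minimal[rotated])
    then show ?thesis using p by (auto simp: omega_limit_def)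
  qed
  then have "norm (F p) \<le> 0" by (metis field_le_epsilon add_0)
  then show ?thesis by simp
qed

lemma infdist_zero_set_tendsto:
  fixes f :: "real \<Rightarrow> 'a::euclidean_space" and F :: "'a \<Rightarrow> 'b::real_normed_vector"
  assumes bdd: "bounded (f ` {0..})" and F: "continuous_on UNIV F"
    and lim: "((\<lambda>t. F (f t)) \<longlongrightarrow> 0) at_top"
    and Z: "{x. F x = 0} \<subseteq> Z"
  shows "Z \<noteq> {}" "((\<lambda>t. infdist (f t) Z) \<longlongrightarrow> 0) at_top"
proof -
  have sub: "omega_limit f \<subseteq> Z" using omega_limit_zero[OF F lim] Z by blast
  then show "Z \<noteq> {}" using omega_limit_nonempty[OF bdd] by blast
  show "((\<lambda>t. infdist (f t) Z) \<longlongrightarrow> 0) at_top"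
  proof (rule tendstoI)
    fix e :: real assume "e > 0"
    have "open {x. infdist x Z < e}"
      by (intro open_Collect_less continuous_intros)
    moreover have "omega_limit f \<subseteq> {x. infdist x Z < e}"
      using sub \<open>e > 0\<close> by auto
    ultimately have "\<forall>\<^sub>F t in at_top. f t \<in> {x. infdist x Z < e}"
      by (rule omega_limit_attracts[OF bdd])
    then show "\<forall>\<^sub>F t in at_top. dist (infdist (f t) Z) 0 < e"
      by (auto simp: infdist_nonneg)
  qed
qed

text \<open>
  The omega-limit set is a connected set of zeros; an isolated point of it is relatively open and
  closed, so nothing else belongs to the set.
\<close>

lemma tendsto_isolated_zero:
  fixes f :: "real \<Rightarrow> 'a::euclidean_space" and F :: "'a \<Rightarrow> 'b::real_normed_vector"
  assumes bdd: "bounded (f ` {0..})" and cont: "continuous_on {0..} f"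
    and F: "continuous_on UNIV F"
    and lim: "((\<lambda>t. F (f t)) \<longlongrightarrow> 0) at_top"
    and iso: "\<And>z. F z = 0 \<Longrightarrow> z isolated_in {z. F z = 0}"
  obtains z where "F z = 0" "(f \<longlongrightarrow> z) at_top"
proof -
  obtain z where z: "z \<in> omega_limit f" using omega_limit_nonempty[OF bdd] by blast
  have Fz: "F z = 0" by (rule omega_limit_zero[OF F lim z])
  have sub: "omega_limit f \<subseteq> {z. F z = 0}" using omega_limit_zero[OF F lim] by blast
  obtain T where T: "open T" "T \<inter> {z. F z = 0} = {z}"
    using iso[OF Fz] by (auto simp: isolated_in_def)
  have "omega_limit f \<subseteq> {z}"
  proof -
    have "T \<inter> omega_limit f = {z}" using T(2) sub z by blast
    moreover have "openin (top_of_set (omega_limit f)) (T \<inter> omega_limit f)"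
      using T(1) by (metis Int_commute openin_open_Int)
    ultimately have "openin (top_of_set (omega_limit f)) {z}" by simp
    moreover have "closedin (top_of_set (omega_limit f)) {z}"
      using z by (intro closed_subset) auto
    ultimately have "{z} = {} \<or> {z} = omega_limit f"
      using connected_omega_limit[OF bdd cont] unfolding connected_clopen by blast
    then show ?thesis by auto
  qed
  then have "(f \<longlongrightarrow> z) at_top"
    by (intro topological_tendstoI omega_limit_attracts[OF bdd]) auto
  with Fz that show ?thesis by blast
qed

section \<open>Relaxation towards a gradient of cocoercive masses\<close>

text \<open>
  Multiplied by \<open>exp r\<close>, the equation says that \<open>exp r *\<^sub>R (\<xi> r - z)\<close> has the derivative
  \<open>exp r *\<^sub>R (y r - z)\<close>: a target that stays near \<open>z\<close> draws \<open>\<xi>\<close> to \<open>z\<close> at an exponential rate.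
\<close>

lemma relaxation_estimate:
  fixes \<xi> y :: "real \<Rightarrow> 'a::real_normed_vector"
  assumes ode: "\<And>r. r \<ge> 0 \<Longrightarrow> (\<xi> has_vector_derivative y r - \<xi> r) (at r within {0..})"
    and st: "0 \<le> s" "s \<le> t"
    and bnd: "\<And>r. s \<le> r \<Longrightarrow> r \<le> t \<Longrightarrow> norm (y r - z) \<le> \<epsilon>"
  shows "norm (\<xi> t - z) \<le> exp (s - t) * norm (\<xi> s - z) + \<epsilon>"
proof (cases "s = t")
  case True
  have "0 \<le> \<epsilon>" using bnd[of s] st norm_ge_zero order_trans by blast
  then show ?thesis using True by simp
next
  case False
  then have "s < t" using st by simp
  define f where "f r = exp (r - s) *\<^sub>R (\<xi> r - z)" for r
  have "norm (f t - f s) \<le> \<epsilon> * exp (t - s) - \<epsilon> * exp (s - s)"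
  proof (rule differentiable_bound_general[OF \<open>s < t\<close>])
    have "continuous_on {0..} \<xi>"
      using ode by (intro continuous_on_vector_derivative) auto
    then have "continuous_on {s..t} \<xi>" by (rule continuous_on_subset) (use st in auto)
    then show "continuous_on {s..t} f" unfolding f_def by (intro continuous_intros)
    show "continuous_on {s..t} (\<lambda>r. \<epsilon> * exp (r - s))" by (intro continuous_intros)
    fix r assume r: "s < r" "r < t"
    have d: "(\<xi> has_vector_derivative y r - \<xi> r) (at r)"
      using ode[of r] r st
      by (metis atLeast_iff at_within_interior interior_real_atLeast greaterThan_iff less_eq_real_def order_le_less_trans)
    have e: "((\<lambda>r. exp (r - s)) has_real_derivative exp (r - s)) (at r)"
      by (auto intro!: derivative_eq_intros)
    show "(f has_vector_derivative exp (r - s) *\<^sub>R (y r - z)) (at r)"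
      unfolding f_def using d e
      by (auto intro!: derivative_eq_intros simp: algebra_simps)
    show "((\<lambda>r. \<epsilon> * exp (r - s)) has_vector_derivative \<epsilon> * exp (r - s)) (at r)"
      using DERIV_cmult[OF e] by (simp add: has_real_derivative_iff_has_vector_derivative)
    show "norm (exp (r - s) *\<^sub>R (y r - z)) \<le> \<epsilon> * exp (r - s)"
      using bnd[of r] r by (simp add: mult.commute)
  qed
  then have "norm (f t) \<le> norm (f s) + \<epsilon> * (exp (t - s) - 1)"
    using norm_triangle_ineq2[of "f t" "f s"] by (simp add: algebra_simps)
  then have "exp (t - s) * norm (\<xi> t - z) \<le> norm (\<xi> s - z) + \<epsilon> * (exp (t - s) - 1)"
    by (simp add: f_def)
  then have "exp (s - t) * (exp (t - s) * norm (\<xi> t - z)) \<le> exp (s - t) * (norm (\<xi> s - z) + \<epsilon> * (exp (t - s) - 1))"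
    by (intro mult_left_mono) auto
  moreover have "exp (s - t) * exp (t - s) = 1" by (simp add: exp_add[symmetric])
  ultimately have "norm (\<xi> t - z) \<le> exp (s - t) * norm (\<xi> s - z) + \<epsilon> * (1 - exp (s - t))"
    by (simp add: algebra_simps) (simp add: mult.assoc[symmetric] mult.commute)
  moreover have "0 \<le> \<epsilon>" using bnd[of s] st norm_ge_zero order_trans by blast
  ultimately show ?thesis by (simp add: algebra_simps) (smt (verit) mult_nonneg_nonneg exp_ge_zero)
qed

lemma relaxation_tendsto:
  fixes \<xi> y :: "real \<Rightarrow> 'a::real_normed_vector"
  assumes ode: "\<And>r. r \<ge> 0 \<Longrightarrow> (\<xi> has_vector_derivative y r - \<xi> r) (at r within {0..})"
    and y: "(y \<longlongrightarrow> z) at_top"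
  shows "(\<xi> \<longlongrightarrow> z) at_top"
proof (rule tendstoI)
  fix e :: real assume "e > 0"
  then have "\<forall>\<^sub>F t in at_top. dist (y t) z < e / 2 \<and> t \<ge> 0"
    using y by (intro eventually_conj tendstoD eventually_ge_at_top) auto
  then obtain s where s: "\<And>t. t \<ge> s \<Longrightarrow> dist (y t) z < e / 2 \<and> t \<ge> 0"
    by (auto simp: eventually_at_top_linorder)
  have "((\<lambda>t. exp (s - t) * norm (\<xi> s - z)) \<longlongrightarrow> 0) at_top"
  proof (rule tendsto_mult_left_zero)
    have "((\<lambda>t. exp s / exp t) \<longlongrightarrow> 0) at_top"
      by (intro tendsto_divide_0[OF tendsto_const] filterlim_at_top_imp_at_infinity exp_at_top)
    then show "((\<lambda>t. exp (s - t)) \<longlongrightarrow> 0) at_top" by (simp add: exp_diff)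
  qed
  then have "\<forall>\<^sub>F t in at_top. dist (exp (s - t) * norm (\<xi> s - z)) 0 < e / 2 \<and> t \<ge> s"
    using \<open>e > 0\<close> by (intro eventually_conj tendstoD eventually_ge_at_top) auto
  then show "\<forall>\<^sub>F t in at_top. dist (\<xi> t) z < e"
  proof (rule eventually_mono, goal_cases)
    case (1 t)
    have "norm (\<xi> t - z) \<le> exp (s - t) * norm (\<xi> s - z) + e / 2"
      by (rule relaxation_estimate[OF ode]) (use s 1 in \<open>auto simp: dist_norm less_imp_le\<close>)
    with 1 show ?case by (simp add: dist_norm)
  qed
qed

lemma norm_add_square_divide_le:
  fixes x y :: "'a::real_normed_vector"
  assumes "p > 0" "q > 0"
  shows "(norm (x + y))\<^sup>2 / (p + q) \<le> (norm x)\<^sup>2 / p + (norm y)\<^sup>2 / q"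
proof -
  define a b where "a = norm x" and "b = norm y"
  have "(norm (x + y))\<^sup>2 \<le> (a + b)\<^sup>2"
    unfolding a_def b_def by (intro power_mono norm_triangle_ineq) auto
  then have "(norm (x + y))\<^sup>2 / (p + q) \<le> (a + b)\<^sup>2 / (p + q)"
    using assms by (intro divide_right_mono) auto
  also have "\<dots> \<le> a\<^sup>2 / p + b\<^sup>2 / q"
  proof -
    have "a\<^sup>2 / p + b\<^sup>2 / q - (a + b)\<^sup>2 / (p + q) = (q * a - p * b)\<^sup>2 / (p * q * (p + q))"
      using assms by (simp add: field_simps power2_eq_square)
    also have "\<dots> \<ge> 0" using assms by simp
    finally show ?thesis by simp
  qed
  finally show ?thesis by (simp add: a_def b_def)
qed

text \<open>
  The abstract setting of the flow. The first two conditions make \<open>- U\<close> a cocoercive selection of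
  subgradients of the convex function \<open>\<Phi>\<close>; cocoercivity replaces the differentiability of \<open>U\<close>,
  which may fail for cell masses.
\<close>

locale gradient_relaxation =
  fixes U :: "'a::euclidean_space \<Rightarrow> 'a" and \<Phi> :: "'a \<Rightarrow> real"
    and G :: "'a \<Rightarrow> real" and G' :: "'a \<Rightarrow> 'a"
    and c :: real and \<xi> :: "real \<Rightarrow> 'a"
  assumes c: "c > 0"
    and subgradient: "\<And>x y. \<Phi> y \<ge> \<Phi> x - U x \<bullet> (y - x)"
    and cocoercive: "\<And>x y. c * (norm (U y - U x))\<^sup>2 \<le> - ((U y - U x) \<bullet> (y - x))"
    and bounded_U: "bounded (range U)"
    and G: "\<And>u. GDERIV G u :> G' u"
    and cont_G': "continuous_on UNIV G'"
    and ode: "\<And>t. t \<ge> 0 \<Longrightarrow> (\<xi> has_vector_derivative G' (U (\<xi> t)) - \<xi> t) (at t within {0..})"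
begin

lemma lipschitz_U: "norm (U y - U x) \<le> (1 / c) * norm (y - x)"
proof (cases "U y = U x")
  case False
  have "c * (norm (U y - U x))\<^sup>2 \<le> norm (U y - U x) * norm (y - x)"
    using cocoercive[of y x] Cauchy_Schwarz_ineq2[of "U y - U x" "y - x"] by linarith
  then have "norm (U y - U x) * (c * norm (U y - U x)) \<le> norm (U y - U x) * norm (y - x)"
    by (simp add: power2_eq_square mult_ac)
  then have "c * norm (U y - U x) \<le> norm (y - x)" using False by simp
  then show ?thesis using c by (simp add: field_simps)
qed (use c in auto)

lemma U_close:
  assumes "norm (y - x) < c * e"
  shows "norm (U y - U x) < e"
proof -
  have "1 / c * norm (y - x) < e" using assms c by (simp add: field_simps)
  then show ?thesis using lipschitz_U[of y x] by linarith
qed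

lemma continuous_U: "continuous_on UNIV U"
  unfolding continuous_on_iff
proof (intro ballI allI impI)
  fix x :: 'a and e :: real assume "e > 0"
  have "dist (U y) (U x) < e" if "dist y x < c * e" for y
    using U_close[of y x] that by (simp add: dist_norm)
  then show "\<exists>d>0. \<forall>y\<in>UNIV. dist y x < d \<longrightarrow> dist (U y) (U x) < e"
    using \<open>e > 0\<close> c by (intro exI[of _ "c * e"]) auto
qed

lemma continuous_Phi: "continuous_on UNIV \<Phi>"
proof -
  obtain B where B: "\<And>x. norm (U x) \<le> B" and "B > 0"
    using bounded_U by (auto simp: bounded_pos)
  have step: "\<Phi> x - \<Phi> y \<le> B * norm (y - x)" for x y
  proof -
    have "\<Phi> x - \<Phi> y \<le> U x \<bullet> (y - x)" using subgradient[of x y] by simp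
    also have "\<dots> \<le> norm (U x) * norm (y - x)" by (rule norm_cauchy_schwarz)
    also have "\<dots> \<le> B * norm (y - x)" by (intro mult_right_mono B) auto
    finally show ?thesis .
  qed
  show ?thesis
    unfolding continuous_on_iff
  proof (intro ballI allI impI)
    fix x :: 'a and e :: real assume "e > 0"
    have "dist (\<Phi> y) (\<Phi> x) < e" if "dist y x < e / B" for y
    proof -
      have "B * norm (y - x) < e" using that \<open>B > 0\<close> by (simp add: dist_norm field_simps)
      then show ?thesis using step[of x y] step[of y x]
        by (simp add: dist_norm norm_minus_commute abs_less_iff)
    qed
    then show "\<exists>d>0. \<forall>y\<in>UNIV. dist y x < d \<longrightarrow> dist (\<Phi> y) (\<Phi> x) < e"
      using \<open>e > 0\<close> \<open>B > 0\<close> by (intro exI[of _ "e / B"]) auto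
  qed
qed

lemma continuous_target: "continuous_on UNIV (\<lambda>x. G' (U x))"
  by (rule continuous_on_compose2[OF cont_G' continuous_U]) auto

lemma bounded_target: "bounded (range (\<lambda>x. G' (U x)))"
proof -
  have "compact (G' ` closure (range U))"
    using bounded_U by (intro compact_continuous_image continuous_on_subset[OF cont_G'])
      (auto simp: compact_closure)
  moreover have "range (\<lambda>x. G' (U x)) \<subseteq> G' ` closure (range U)"
    using closure_subset by fastforce
  ultimately show ?thesis using bounded_subset compact_imp_bounded by blast
qed

lemma continuous_flow: "continuous_on {0..} \<xi>"
  using ode by (intro continuous_on_vector_derivative) auto

lemma bounded_flow: "bounded (\<xi> ` {0..})"
proof -
  obtain R where R: "\<And>x. norm (G' (U x)) \<le> R"
    using bounded_target by (auto simp: bounded_iff)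
  have "norm (\<xi> t) \<le> norm (\<xi> 0) + R" if "t \<ge> 0" for t
  proof -
    have "norm (\<xi> t - 0) \<le> exp (0 - t) * norm (\<xi> 0 - 0) + R"
      by (rule relaxation_estimate[OF ode]) (use that R in auto)
    also have "exp (0 - t) * norm (\<xi> 0 - 0) \<le> 1 * norm (\<xi> 0 - 0)"
      using that by (intro mult_right_mono) auto
    finally show ?thesis by simp
  qed
  then show ?thesis by (auto simp: bounded_iff)
qed

text \<open>
  For differentiable \<open>U\<close> the chain rule gives \<open>(G' (U x) - x) \<bullet> DU x v\<close> as the derivative of this
  function in direction \<open>v\<close>, because \<open>\<nabla>\<Phi> = - U\<close> cancels the derivative of the factor \<open>x\<close>. Along the
  flow this is \<open>\<xi>' \<bullet> (U \<circ> \<xi>)'\<close>.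
\<close>

definition energy :: "'a \<Rightarrow> real" where
  "energy x = G (U x) - x \<bullet> U x - \<Phi> x"

lemma continuous_energy: "continuous_on UNIV energy"
proof -
  have "continuous_on UNIV G"
    using G unfolding gderiv_def by (intro has_derivative_continuous_on) (auto intro: has_derivative_at_withinI)
  then have "continuous_on UNIV (\<lambda>x. G (U x))"
    by (rule continuous_on_compose2[OF _ continuous_U]) auto
  then show ?thesis
    unfolding energy_def by (intro continuous_intros continuous_U continuous_Phi)
qed

text \<open>
  Continuity of the gradient makes the linear approximation at \<open>w\<close> valid for increments between any
  two points near \<open>w\<close>. The increments of the masses over intervals around a time \<open>x\<close> are of that
  kind.
\<close>

lemma gradient_strict:
  assumes "e > 0"
  obtains d where "d > 0"
    "\<And>u v. dist u w < d \<Longrightarrow> dist v w < d \<Longrightarrow> \<bar>G v - G u - G' w \<bullet> (v - u)\<bar> \<le> e * norm (v - u)"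
proof -
  have "continuous (at w) G'" using cont_G' by (simp add: continuous_on_eq_continuous_at)
  then obtain d where d: "d > 0" "\<And>x. dist x w < d \<Longrightarrow> dist (G' x) (G' w) < e"
    using assms unfolding continuous_at_eps_delta by blast
  show ?thesis
  proof (rule that[OF d(1)])
    fix u v assume uv: "dist u w < d" "dist v w < d"
    define H where "H x = G x - G' w \<bullet> x" for x
    have "norm (H v - H u) \<le> e * norm (v - u)"
    proof (rule differentiable_bound)
      show "convex (ball w d)" by simp
      fix x assume x: "x \<in> ball w d"
      show "(H has_derivative (\<lambda>h. (G' x - G' w) \<bullet> h)) (at x within ball w d)"
        unfolding H_def using G[of x, unfolded gderiv_def]
        by (auto intro!: derivative_eq_intros has_derivative_at_withinI[where s="ball w d"]
            simp: inner_diff_left inner_diff_right inner_commute)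
      show "onorm (\<lambda>h. (G' x - G' w) \<bullet> h) \<le> e"
      proof (rule onorm_bound)
        fix h
        have "norm ((G' x - G' w) \<bullet> h) \<le> norm (G' x - G' w) * norm h"
          using Cauchy_Schwarz_ineq2 by simp
        also have "\<dots> \<le> e * norm h"
          using d(2)[of x] x by (intro mult_right_mono) (auto simp: dist_norm norm_minus_commute less_imp_le)
        finally show "norm ((G' x - G' w) \<bullet> h) \<le> e * norm h" .
      qed (use assms in auto)
    qed (use uv in \<open>auto simp: dist_commute\<close>)
    then show "\<bar>G v - G u - G' w \<bullet> (v - u)\<bar> \<le> e * norm (v - u)"
      by (simp add: H_def inner_diff_right algebra_simps)
  qed
qed

lemma flow_strict:
  assumes "x \<ge> 0" "e > 0"
  obtains d where "d > 0"
    "\<And>s t. 0 \<le> s \<Longrightarrow> s \<le> x \<Longrightarrow> x \<le> t \<Longrightarrow> t - s < d \<Longrightarrow>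
       norm (\<xi> t - \<xi> s - (t - s) *\<^sub>R (G' (U (\<xi> x)) - \<xi> x)) \<le> e * (t - s)"
proof -
  define v where "v = G' (U (\<xi> x)) - \<xi> x"
  obtain d where d: "d > 0"
    "\<And>t. t \<ge> 0 \<Longrightarrow> dist t x < d \<Longrightarrow> norm (\<xi> t - \<xi> x - (t - x) *\<^sub>R v) \<le> e * \<bar>t - x\<bar>"
    using ode[OF assms(1)] assms(2)
    unfolding has_vector_derivative_def has_derivative_within_alt v_def
    by (fastforce simp: dist_real_def)
  show ?thesis
  proof (rule that[OF d(1)])
    fix s t assume st: "0 \<le> s" "s \<le> x" "x \<le> t" "t - s < d"
    have "norm (\<xi> t - \<xi> s - (t - s) *\<^sub>R v)
        = norm ((\<xi> t - \<xi> x - (t - x) *\<^sub>R v) - (\<xi> s - \<xi> x - (s - x) *\<^sub>R v))"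
      by (simp add: algebra_simps)
    also have "\<dots> \<le> e * \<bar>t - x\<bar> + e * \<bar>s - x\<bar>"
      using d(2)[of t] d(2)[of s] st assms
        norm_triangle_ineq4[of "\<xi> t - \<xi> x - (t - x) *\<^sub>R v" "\<xi> s - \<xi> x - (s - x) *\<^sub>R v"]
      by (auto simp: dist_real_def)
    also have "\<dots> = e * (t - s)" using st by (simp add: algebra_simps)
    finally show "norm (\<xi> t - \<xi> s - (t - s) *\<^sub>R (G' (U (\<xi> x)) - \<xi> x)) \<le> e * (t - s)"
      by (simp add: v_def)
  qed
qed

lemma energy_increment:
  "energy y - energy x \<le> G (U y) - G (U x) - y \<bullet> (U y - U x)"
  using subgradient[of x y] by (simp add: energy_def inner_diff_right inner_diff_left inner_commute)

text \<open>
  In \<open>energy (\<xi> t) - energy (\<xi> s) \<le> G (U (\<xi> t)) - G (U (\<xi> s)) - \<xi> t \<bullet> \<Delta>\<close>, where \<open>\<Delta>\<close> is the increment of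
  the masses, the right-hand side is \<open>v \<bullet> \<Delta>\<close> up to \<open>o(|\<Delta>|)\<close> for the velocity \<open>v\<close> at time \<open>x\<close>. The
  increment of \<open>\<xi>\<close> is \<open>(t - s) v\<close> up to \<open>o(t - s)\<close>, so cocoercivity bounds \<open>v \<bullet> \<Delta>\<close> by
  \<open>- c |\<Delta>|\<^sup>2 / (t - s)\<close> up to \<open>o(|\<Delta>|)\<close>; and \<open>|\<Delta>| = O(t - s)\<close> since \<open>U\<close> is Lipschitz.
\<close>

lemma dissipation_local:
  assumes "x \<ge> 0" "\<epsilon> > 0"
  obtains d where "d > 0"
    "\<And>s t. 0 \<le> s \<Longrightarrow> s \<le> x \<Longrightarrow> x \<le> t \<Longrightarrow> t - s < d \<Longrightarrow>
       energy (\<xi> t) - energy (\<xi> s) + c * (norm (U (\<xi> t) - U (\<xi> s)))\<^sup>2 / (t - s) \<le> \<epsilon> * (t - s)"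
proof -
  define v where "v = G' (U (\<xi> x)) - \<xi> x"
  \<comment> \<open>a Lipschitz constant near time x of the masses along the curve\<close>
  define K where "K = (norm v + 1) / c"
  have "K > 0" using c norm_ge_zero[of v] by (simp add: K_def add_nonneg_pos)
  \<comment> \<open>the three error terms are each at most e times the increment of the masses\<close>
  obtain e where e: "e > 0" "e \<le> 1" "3 * e * K \<le> \<epsilon>"
  proof
    have "0 < \<epsilon> / (3 * K)" using assms(2) \<open>K > 0\<close> by simp
    then show "0 < min 1 (\<epsilon> / (3 * K))" by simp
    show "min 1 (\<epsilon> / (3 * K)) \<le> 1" by simp
    have "3 * min 1 (\<epsilon> / (3 * K)) * K \<le> 3 * (\<epsilon> / (3 * K)) * K"
      using \<open>K > 0\<close> by (intro mult_right_mono mult_left_mono) auto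
    also have "\<dots> = \<epsilon>" using \<open>K > 0\<close> by simp
    finally show "3 * min 1 (\<epsilon> / (3 * K)) * K \<le> \<epsilon>" .
  qed
  obtain dg where dg: "dg > 0" "\<And>u w. dist u (U (\<xi> x)) < dg \<Longrightarrow> dist w (U (\<xi> x)) < dg \<Longrightarrow>
      \<bar>G w - G u - G' (U (\<xi> x)) \<bullet> (w - u)\<bar> \<le> e * norm (w - u)"
    using gradient_strict[OF e(1)] by blast
  obtain df where df: "df > 0" "\<And>s t. 0 \<le> s \<Longrightarrow> s \<le> x \<Longrightarrow> x \<le> t \<Longrightarrow> t - s < df \<Longrightarrow>
       norm (\<xi> t - \<xi> s - (t - s) *\<^sub>R v) \<le> e * (t - s)"
    using flow_strict[OF assms(1) e(1)] unfolding v_def by blast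
  have "continuous (at x within {0..}) \<xi>"
    using continuous_flow assms by (simp add: continuous_on_eq_continuous_within)
  then obtain dx where dx: "dx > 0" "\<And>t. t \<ge> 0 \<Longrightarrow> dist t x < dx \<Longrightarrow> dist (\<xi> t) (\<xi> x) < min e (c * dg)"
    unfolding continuous_within_eps_delta using e(1) c dg(1)
    by (metis atLeast_iff min_less_iff_conj mult_pos_pos)
  show ?thesis
  proof (rule that)
    show "min df dx > 0" using df dx by simp
    fix s t assume st: "0 \<le> s" "s \<le> x" "x \<le> t" "t - s < min df dx"
    define h where "h = t - s"
    define \<Delta> where "\<Delta> = U (\<xi> t) - U (\<xi> s)"
    have "h \<ge> 0" using st by (simp add: h_def)
    show "energy (\<xi> t) - energy (\<xi> s) + c * (norm (U (\<xi> t) - U (\<xi> s)))\<^sup>2 / (t - s) \<le> \<epsilon> * (t - s)"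
    proof (cases "h = 0")
      case True then show ?thesis by (simp add: h_def)
    next
      case False
      then have "h > 0" using \<open>h \<ge> 0\<close> by simp
      have near: "dist (\<xi> r) (\<xi> x) < e" "dist (U (\<xi> r)) (U (\<xi> x)) < dg" if "r \<in> {s..t}" for r
      proof -
        have *: "dist (\<xi> r) (\<xi> x) < min e (c * dg)" using that st by (intro dx(2)) (auto simp: dist_norm)
        then show "dist (\<xi> r) (\<xi> x) < e" by simp
        show "dist (U (\<xi> r)) (U (\<xi> x)) < dg"
          using U_close[of "\<xi> r" "\<xi> x"] * by (simp add: dist_norm)
      qed
      have f: "norm (\<xi> t - \<xi> s - h *\<^sub>R v) \<le> e * h" using df(2)[of s t] st by (simp add: h_def)
      have "norm \<Delta> \<le> K * h"
      proof -
        have "norm (\<xi> t - \<xi> s) \<le> norm (h *\<^sub>R v) + norm (\<xi> t - \<xi> s - h *\<^sub>R v)"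
          by (metis add.commute diff_add_cancel norm_triangle_ineq)
        also have "\<dots> \<le> h * norm v + 1 * h"
          using f \<open>h > 0\<close> e(2) by (intro add_mono) (auto intro: order_trans mult_right_mono)
        finally have "norm (\<xi> t - \<xi> s) \<le> (norm v + 1) * h" by (simp add: algebra_simps)
        then have "1 / c * norm (\<xi> t - \<xi> s) \<le> 1 / c * ((norm v + 1) * h)"
          using c by (intro mult_left_mono) auto
        also have "\<dots> = K * h" by (simp add: K_def)
        finally show ?thesis using lipschitz_U[of "\<xi> t" "\<xi> s"] unfolding \<Delta>_def by linarith
      qed
      have "G (U (\<xi> t)) - G (U (\<xi> s)) \<le> G' (U (\<xi> x)) \<bullet> \<Delta> + e * norm \<Delta>"
        using dg(2)[OF near(2) near(2), of s t] st by (simp add: \<Delta>_def abs_le_iff)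
      then have "energy (\<xi> t) - energy (\<xi> s) \<le> G' (U (\<xi> x)) \<bullet> \<Delta> + e * norm \<Delta> - \<xi> t \<bullet> \<Delta>"
        using energy_increment[of "\<xi> t" "\<xi> s"] by (simp add: \<Delta>_def)
      also have "\<dots> = v \<bullet> \<Delta> + e * norm \<Delta> - (\<xi> t - \<xi> x) \<bullet> \<Delta>"
        by (simp add: v_def inner_diff_left)
      also have "\<dots> \<le> v \<bullet> \<Delta> + 2 * e * norm \<Delta>"
      proof -
        have "- ((\<xi> t - \<xi> x) \<bullet> \<Delta>) \<le> norm (\<xi> t - \<xi> x) * norm \<Delta>"
          using Cauchy_Schwarz_ineq2[of "\<xi> t - \<xi> x" \<Delta>] by linarith
        also have "\<dots> \<le> e * norm \<Delta>"
          using near(1)[of t] st by (intro mult_right_mono) (auto simp: dist_norm)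
        finally show ?thesis by simp
      qed
      also have "v \<bullet> \<Delta> \<le> - (c * (norm \<Delta>)\<^sup>2 / h) + e * norm \<Delta>"
      proof -
        have "h * (v \<bullet> \<Delta>) = \<Delta> \<bullet> (\<xi> t - \<xi> s) - (\<xi> t - \<xi> s - h *\<^sub>R v) \<bullet> \<Delta>"
          by (simp add: inner_diff_left inner_diff_right inner_commute)
        also have "\<dots> \<le> - (c * (norm \<Delta>)\<^sup>2) + e * h * norm \<Delta>"
        proof -
          have "- ((\<xi> t - \<xi> s - h *\<^sub>R v) \<bullet> \<Delta>) \<le> norm (\<xi> t - \<xi> s - h *\<^sub>R v) * norm \<Delta>"
            using Cauchy_Schwarz_ineq2[of "\<xi> t - \<xi> s - h *\<^sub>R v" \<Delta>] by linarith
          also have "\<dots> \<le> e * h * norm \<Delta>" using f by (intro mult_right_mono) auto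
          finally show ?thesis using cocoercive[of "\<xi> t" "\<xi> s"] by (simp add: \<Delta>_def)
        qed
        finally have "v \<bullet> \<Delta> \<le> (- (c * (norm \<Delta>)\<^sup>2) + e * h * norm \<Delta>) / h"
          using \<open>h > 0\<close> by (simp add: pos_le_divide_eq mult.commute)
        also have "\<dots> = - (c * (norm \<Delta>)\<^sup>2 / h) + e * norm \<Delta>"
          using \<open>h > 0\<close> by (simp add: diff_divide_distrib)
        finally show ?thesis .
      qed
      finally have "energy (\<xi> t) - energy (\<xi> s) + c * (norm \<Delta>)\<^sup>2 / h \<le> 3 * e * norm \<Delta>" by simp
      also have "\<dots> \<le> 3 * e * (K * h)" using \<open>norm \<Delta> \<le> K * h\<close> e(1) by (intro mult_left_mono) auto
      also have "\<dots> = (3 * e * K) * h" by simp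
      also have "\<dots> \<le> \<epsilon> * h" using e(3) \<open>h > 0\<close> by (intro mult_right_mono) auto
      finally show ?thesis by (simp add: \<Delta>_def h_def)
    qed
  qed
qed

text \<open>
  The left-hand side is subadditive under concatenation of intervals, by convexity of the square, and
  it is at most \<open>\<epsilon> (t - s)\<close> on short intervals around each time. Bolzano's bisection carries this
  bound over to all intervals, for every \<open>\<epsilon>\<close>.
\<close>

lemma dissipation:
  assumes "0 \<le> s" "s \<le> t"
  shows "energy (\<xi> t) - energy (\<xi> s) + c * (norm (U (\<xi> t) - U (\<xi> s)))\<^sup>2 / (t - s) \<le> 0"
proof -
  define E where "E s t = energy (\<xi> t) - energy (\<xi> s) + c * (norm (U (\<xi> t) - U (\<xi> s)))\<^sup>2 / (t - s)" for s t
  have E_trans: "E p r \<le> E p q + E q r" if "p \<le> q" "q \<le> r" for p q r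
  proof (cases "p = q \<or> q = r")
    case True then show ?thesis by (auto simp: E_def)
  next
    case False
    then have pq: "q - p > 0" "r - q > 0" using that by auto
    have "(norm (U (\<xi> r) - U (\<xi> p)))\<^sup>2 / (r - p)
        \<le> (norm (U (\<xi> r) - U (\<xi> q)))\<^sup>2 / (r - q) + (norm (U (\<xi> q) - U (\<xi> p)))\<^sup>2 / (q - p)"
      using norm_add_square_divide_le[OF pq(2,1), of "U (\<xi> r) - U (\<xi> q)" "U (\<xi> q) - U (\<xi> p)"] by simp
    from mult_left_mono[OF this, of c] c show ?thesis by (simp add: E_def distrib_left)
  qed
  have "E s t \<le> \<epsilon> * (t - s)" if pos: "\<epsilon> > 0" for \<epsilon>
  proof -
    have "0 \<le> s \<longrightarrow> E s t \<le> \<epsilon> * (t - s)"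
      using assms(2)
    proof (induction s t rule: Bolzano)
      case (trans p q r)
      then show ?case using E_trans[of p q r] by (auto simp: algebra_simps)
    next
      case (local x)
      then have "x \<ge> 0" using assms by simp
      obtain d where "d > 0" and d: "\<And>s t. 0 \<le> s \<Longrightarrow> s \<le> x \<Longrightarrow> x \<le> t \<Longrightarrow> t - s < d \<Longrightarrow> E s t \<le> \<epsilon> * (t - s)"
        using dissipation_local[OF \<open>x \<ge> 0\<close> pos] unfolding E_def by blast
      then show ?case by blast
    qed
    then show ?thesis using assms by simp
  qed
  note bound = this
  have "E s t \<le> 0"
  proof (rule field_le_epsilon)
    fix e :: real assume "e > 0"
    have pos: "e / (t - s + 1) > 0" using \<open>e > 0\<close> assms by simp
    have "e / (t - s + 1) * (t - s) \<le> e" using \<open>e > 0\<close> assms by (simp add: field_simps)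
    then show "E s t \<le> 0 + e" using bound[OF pos] by linarith
  qed
  then show ?thesis by (simp add: E_def)
qed

lemma energy_antimono:
  assumes "0 \<le> s" "s \<le> t"
  shows "energy (\<xi> t) \<le> energy (\<xi> s)"
proof -
  have "0 \<le> c * (norm (U (\<xi> t) - U (\<xi> s)))\<^sup>2 / (t - s)" using c assms by simp
  then show ?thesis using dissipation[OF assms] by linarith
qed

lemma energy_increment_tendsto_0: "((\<lambda>t. energy (\<xi> t) - energy (\<xi> (t + \<tau>))) \<longlongrightarrow> 0) at_top"
proof -
  have "compact (energy ` closure (\<xi> ` {0..}))"
    using bounded_flow by (intro compact_continuous_image continuous_on_subset[OF continuous_energy])
      (auto simp: compact_closure)
  then have "bounded (energy ` closure (\<xi> ` {0..}))" by (rule compact_imp_bounded)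
  then obtain B where "\<And>x. x \<in> closure (\<xi> ` {0..}) \<Longrightarrow> norm (energy x) \<le> B"
    by (auto simp: bounded_iff)
  then have B: "- B \<le> energy (\<xi> t)" if "t \<ge> 0" for t
    using that closure_subset[of "\<xi> ` {0..}"] by (fastforce simp: abs_le_iff)
  define l where "l = Inf ((\<lambda>t. energy (\<xi> t)) ` {0..})"
  have bdd: "bdd_below ((\<lambda>t. energy (\<xi> t)) ` {0..})" using B by (auto intro!: bdd_belowI[of _ "- B"])
  have lim: "((\<lambda>t. energy (\<xi> t)) \<longlongrightarrow> l) at_top"
  proof (rule order_tendstoI)
    fix y assume "y < l"
    have "y < energy (\<xi> t)" if "t \<ge> 0" for t
      using \<open>y < l\<close> cInf_lower[OF _ bdd, of "energy (\<xi> t)"] that unfolding l_def by fastforce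
    then show "\<forall>\<^sub>F t in at_top. y < energy (\<xi> t)" by (auto simp: eventually_at_top_linorder)
  next
    fix y assume "l < y"
    then obtain t where t: "t \<ge> 0" "energy (\<xi> t) < y"
      unfolding l_def using cInf_lessD[of "(\<lambda>t. energy (\<xi> t)) ` {0..}" y] by auto
    then have "energy (\<xi> r) < y" if "r \<ge> t" for r using energy_antimono[OF t(1) that] by simp
    then show "\<forall>\<^sub>F t in at_top. energy (\<xi> t) < y" by (auto simp: eventually_at_top_linorder)
  qed
  have "filterlim (\<lambda>t. t + \<tau>) at_top at_top"
    using filterlim_tendsto_add_at_top[OF tendsto_const filterlim_ident, of \<tau>] by (simp add: add.commute)
  from filterlim_compose[OF lim this] have "((\<lambda>t. energy (\<xi> (t + \<tau>))) \<longlongrightarrow> l) at_top" .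
  from tendsto_diff[OF lim this] show ?thesis by simp
qed

text \<open>
  The energy converges, so its decrease over a window of fixed length tends to 0, and by the
  dissipation inequality so does the variation of the masses over the window.
\<close>

lemma U_slowly_varying:
  assumes "\<tau> > 0" "\<epsilon> > 0"
  shows "\<forall>\<^sub>F t in at_top. \<forall>r\<in>{t..t + \<tau>}. norm (U (\<xi> r) - U (\<xi> t)) < \<epsilon>"
proof -
  have "\<forall>\<^sub>F t in at_top. energy (\<xi> t) - energy (\<xi> (t + \<tau>)) < c * \<epsilon>\<^sup>2 / \<tau>"
    using assms c by (intro order_tendstoD[OF energy_increment_tendsto_0]) auto
  then have "\<forall>\<^sub>F t in at_top. energy (\<xi> t) - energy (\<xi> (t + \<tau>)) < c * \<epsilon>\<^sup>2 / \<tau> \<and> t \<ge> 0"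
    by (intro eventually_conj eventually_ge_at_top)
  then show ?thesis
  proof (rule eventually_mono, intro ballI)
    fix t r assume t: "energy (\<xi> t) - energy (\<xi> (t + \<tau>)) < c * \<epsilon>\<^sup>2 / \<tau> \<and> t \<ge> 0" and r: "r \<in> {t..t + \<tau>}"
    show "norm (U (\<xi> r) - U (\<xi> t)) < \<epsilon>"
    proof (cases "r = t")
      case False
      then have "r - t > 0" using r by simp
      have "c * (norm (U (\<xi> r) - U (\<xi> t)))\<^sup>2 / \<tau> \<le> c * (norm (U (\<xi> r) - U (\<xi> t)))\<^sup>2 / (r - t)"
        using r \<open>r - t > 0\<close> c by (intro divide_left_mono) auto
      also have "\<dots> \<le> energy (\<xi> t) - energy (\<xi> r)"
        using dissipation[of t r] t r by simp
      also have "\<dots> \<le> energy (\<xi> t) - energy (\<xi> (t + \<tau>))"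
        using energy_antimono[of r "t + \<tau>"] t r by simp
      also have "\<dots> < c * \<epsilon>\<^sup>2 / \<tau>" using t by simp
      finally have "(norm (U (\<xi> r) - U (\<xi> t)))\<^sup>2 < \<epsilon>\<^sup>2"
        using c assms(1) by (simp add: divide_less_cancel)
      then show ?thesis by (rule power2_less_imp_less) (use assms in simp)
    qed (use assms in simp)
  qed
qed

lemma target_slowly_varying:
  assumes "\<tau> > 0" "\<epsilon> > 0"
  shows "\<forall>\<^sub>F t in at_top. \<forall>r\<in>{t..t + \<tau>}. norm (G' (U (\<xi> r)) - G' (U (\<xi> t))) < \<epsilon>"
proof -
  have "uniformly_continuous_on (closure (range U)) G'"
    using bounded_U by (intro compact_uniformly_continuous continuous_on_subset[OF cont_G'])
      (auto simp: compact_closure)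
  then obtain d where d: "d > 0"
    "\<And>u w. u \<in> closure (range U) \<Longrightarrow> w \<in> closure (range U) \<Longrightarrow> dist w u < d \<Longrightarrow> dist (G' w) (G' u) < \<epsilon>"
    using assms(2) unfolding uniformly_continuous_on_def by blast
  have "\<forall>\<^sub>F t in at_top. \<forall>r\<in>{t..t + \<tau>}. norm (U (\<xi> r) - U (\<xi> t)) < d"
    by (rule U_slowly_varying[OF assms(1) d(1)])
  then show ?thesis
    using d(2) closure_subset[of "range U"]
    by (auto elim!: eventually_mono simp: dist_norm subset_iff)
qed

text \<open>
  Over a window of length \<open>\<tau>\<close> at a late time \<open>t\<close>, neither \<open>U \<circ> \<xi>\<close> nor the target changes much. The
  curve thus comes within \<open>O(exp (- \<tau>))\<close> of the target \<open>z\<close> at time \<open>t\<close>, while its masses stay near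
  \<open>U (\<xi> t)\<close>; since \<open>U\<close> is Lipschitz, \<open>U z\<close> is near \<open>U (\<xi> t)\<close>.
\<close>

theorem U_target_minus_U_tendsto_0:
  "((\<lambda>t. U (G' (U (\<xi> t))) - U (\<xi> t)) \<longlongrightarrow> 0) at_top"
proof (rule tendstoI)
  fix e :: real assume "e > 0"
  obtain R where R: "\<And>x. norm (G' (U x)) \<le> R" using bounded_target by (auto simp: bounded_iff)
  obtain S where S: "\<And>t. t \<ge> 0 \<Longrightarrow> norm (\<xi> t) \<le> S" using bounded_flow by (auto simp: bounded_iff)
  define \<delta> where "\<delta> = c * e / 4"
  have "\<delta> > 0" using c \<open>e > 0\<close> by (simp add: \<delta>_def)
  have "\<forall>\<^sub>F \<tau> in at_top. exp (- \<tau>) * (S + R) < \<delta> \<and> \<tau> > 0"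
  proof (intro eventually_conj eventually_gt_at_top order_tendstoD)
    have "((\<lambda>\<tau>::real. exp (- \<tau>)) \<longlongrightarrow> 0) at_top"
      by (rule filterlim_compose[OF exp_at_bot filterlim_uminus_at_bot_at_top])
    then show "((\<lambda>\<tau>. exp (- \<tau>) * (S + R)) \<longlongrightarrow> 0) at_top" by (rule tendsto_mult_left_zero)
  qed (rule \<open>\<delta> > 0\<close>)
  then obtain \<tau> :: real where \<tau>: "exp (- \<tau>) * (S + R) < \<delta>" "\<tau> > 0"
    by (auto dest: eventually_happens)
  have "\<forall>\<^sub>F t in at_top. (\<forall>r\<in>{t..t + \<tau>}. norm (G' (U (\<xi> r)) - G' (U (\<xi> t))) < \<delta>)
      \<and> (\<forall>r\<in>{t..t + \<tau>}. norm (U (\<xi> r) - U (\<xi> t)) < e / 2) \<and> t \<ge> 0"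
    using \<tau>(2) \<open>\<delta> > 0\<close> \<open>e > 0\<close>
    by (intro eventually_conj target_slowly_varying U_slowly_varying eventually_ge_at_top) auto
  then show "\<forall>\<^sub>F t in at_top. dist (U (G' (U (\<xi> t))) - U (\<xi> t)) 0 < e"
  proof (rule eventually_mono, goal_cases)
    case (1 t)
    define z where "z = G' (U (\<xi> t))"
    have "norm (\<xi> (t + \<tau>) - z) \<le> exp (t - (t + \<tau>)) * norm (\<xi> t - z) + \<delta>"
      by (rule relaxation_estimate[OF ode]) (use 1 \<tau>(2) in \<open>auto simp: z_def intro: less_imp_le\<close>)
    also have "exp (t - (t + \<tau>)) * norm (\<xi> t - z) \<le> exp (- \<tau>) * (S + R)"
      using S[of t] R[of "\<xi> t"] 1
      by (auto intro!: mult_left_mono order_trans[OF norm_triangle_ineq4] add_mono simp: z_def)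
    finally have "norm (z - \<xi> (t + \<tau>)) < 2 * \<delta>" using \<tau>(1) by (simp add: norm_minus_commute)
    then have "norm (U z - U (\<xi> (t + \<tau>))) < e / 2"
      by (intro U_close) (simp add: \<delta>_def)
    moreover have "norm (U (\<xi> (t + \<tau>)) - U (\<xi> t)) < e / 2" using 1 \<tau>(2) by auto
    moreover have "norm (U z - U (\<xi> t)) \<le> norm (U z - U (\<xi> (t + \<tau>))) + norm (U (\<xi> (t + \<tau>)) - U (\<xi> t))"
      using norm_triangle_ineq[of "U z - U (\<xi> (t + \<tau>))" "U (\<xi> (t + \<tau>)) - U (\<xi> t)"] by simp
    ultimately show ?case by (simp add: z_def)
  qed
qed

theorem infdist_tendsto_0:
  assumes "{x. U (G' (U x)) = U x} \<subseteq> Z"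
  shows "Z \<noteq> {}" "((\<lambda>t. infdist (\<xi> t) Z) \<longlongrightarrow> 0) at_top"
proof -
  have *: "continuous_on UNIV (\<lambda>x. U (G' (U x)) - U x)"
    by (intro continuous_on_diff continuous_U continuous_on_compose2[OF continuous_U continuous_target]) auto
  show "Z \<noteq> {}" "((\<lambda>t. infdist (\<xi> t) Z) \<longlongrightarrow> 0) at_top"
    using infdist_zero_set_tendsto[OF bounded_flow * U_target_minus_U_tendsto_0, of Z] assms by auto
qed

text \<open>
  The curve \<open>\<xi>\<close> itself may stay away from the equilibria for long, but its target \<open>y\<close> does not: applying
  \<open>G'\<close> to the limit relation \<open>U y - U \<xi> \<longlonglongrightarrow> 0\<close> shows that \<open>y\<close> is asymptotically a fixed point. The
  convergence of \<open>y\<close> is then inherited by \<open>\<xi>\<close>.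
\<close>

theorem tendsto_isolated_equilibrium:
  assumes iso: "\<And>z. G' (U z) - z = 0 \<Longrightarrow> z isolated_in {z. G' (U z) - z = 0}"
  obtains z where "G' (U z) - z = 0" "(\<xi> \<longlongrightarrow> z) at_top"
proof -
  define y where "y t = G' (U (\<xi> t))" for t
  have bdd: "bounded (y ` {0..})"
    using bounded_target by (rule bounded_subset) (auto simp: y_def)
  have cont: "continuous_on {0..} y"
    unfolding y_def by (rule continuous_on_compose2[OF continuous_target continuous_flow]) auto
  have "((\<lambda>t. G' (U (y t)) - y t) \<longlongrightarrow> 0) at_top"
  proof (rule tendstoI)
    fix e :: real assume "e > 0"
    have "uniformly_continuous_on (closure (range U)) G'"
      using bounded_U by (intro compact_uniformly_continuous continuous_on_subset[OF cont_G'])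
        (auto simp: compact_closure)
    then obtain d where d: "d > 0"
      "\<And>u w. u \<in> closure (range U) \<Longrightarrow> w \<in> closure (range U) \<Longrightarrow> dist w u < d \<Longrightarrow> dist (G' w) (G' u) < e"
      using \<open>e > 0\<close> unfolding uniformly_continuous_on_def by blast
    have "\<forall>\<^sub>F t in at_top. dist (U (y t) - U (\<xi> t)) 0 < d"
      using tendstoD[OF U_target_minus_U_tendsto_0 d(1)] by (simp add: y_def)
    then show "\<forall>\<^sub>F t in at_top. dist (G' (U (y t)) - y t) 0 < e"
      using d(2) closure_subset[of "range U"]
      by (auto elim!: eventually_mono simp: dist_norm subset_iff y_def)
  qed
  moreover have "continuous_on UNIV (\<lambda>z. G' (U z) - z)"
    by (intro continuous_on_diff continuous_on_id continuous_target)
  ultimately obtain z where z: "G' (U z) - z = 0" "(y \<longlongrightarrow> z) at_top"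
    using tendsto_isolated_zero[OF bdd cont _ _ iso] by blast
  have "(\<xi> \<longlongrightarrow> z) at_top"
    by (rule relaxation_tendsto[OF _ z(2)]) (use ode in \<open>simp add: y_def\<close>)
  with z that show ?thesis by blast
qed

end

section \<open>Cell masses of a semi-discrete transport problem\<close>

definition envelope :: "('n::finite \<Rightarrow> real^2) \<Rightarrow> real^'n \<Rightarrow> real^2 \<Rightarrow> real" where
  "envelope a \<xi> x = (MAX i. a i \<bullet> x - \<xi> $ i)"

lemma envelope_ge: "a i \<bullet> x - \<xi> $ i \<le> envelope a \<xi> x"
  unfolding envelope_def by (intro Max_ge) auto

lemma envelope_attained: obtains i where "envelope a \<xi> x = a i \<bullet> x - \<xi> $ i"
proof -
  have "envelope a \<xi> x \<in> range (\<lambda>i. a i \<bullet> x - \<xi> $ i)"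
    unfolding envelope_def by (intro Max_in) auto
  with that show ?thesis by auto
qed

lemma envelope_on_cell: "x \<in> cell D a \<xi> i \<Longrightarrow> envelope a \<xi> x = a i \<bullet> x - \<xi> $ i"
  unfolding envelope_def
proof (rule Max_eqI)
  fix y assume "x \<in> cell D a \<xi> i" "y \<in> range (\<lambda>i. a i \<bullet> x - \<xi> $ i)"
  then show "y \<le> a i \<bullet> x - \<xi> $ i" by (fastforce simp: cell_def less_imp_le)
qed auto

lemma borel_measurable_envelope [measurable]: "envelope a \<xi> \<in> borel_measurable borel"
  unfolding envelope_def by measurable

text \<open>
  Expanding \<open>|x - a i|\<^sup>2\<close> turns the minimum of the reduced costs into a maximum of affine functions; this
  is the dictionary between potentials and the vectors \<open>\<eta>\<close> that define the cells.
\<close>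

lemma c_transform_eq_envelope:
  assumes "\<And>i. \<psi> (a i) = (norm (a i))\<^sup>2 - 2 * \<eta> $ i"
  shows "c_transform a \<psi> x = (norm x)\<^sup>2 - 2 * envelope a \<eta> x"
proof -
  have eq: "cost x (a i) - \<psi> (a i) = (norm x)\<^sup>2 - 2 * (a i \<bullet> x - \<eta> $ i)" for i
    by (simp add: cost_def assms power2_norm_eq_inner inner_diff_left inner_diff_right inner_commute)
  obtain k where k: "envelope a \<eta> x = a k \<bullet> x - \<eta> $ k" by (rule envelope_attained)
  show ?thesis
  proof (rule antisym)
    show "c_transform a \<psi> x \<le> (norm x)\<^sup>2 - 2 * envelope a \<eta> x"
      unfolding c_transform_def k eq[symmetric] by (intro cINF_lower) auto
    show "(norm x)\<^sup>2 - 2 * envelope a \<eta> x \<le> c_transform a \<psi> x"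
      unfolding c_transform_def eq
    proof (rule cINF_greatest)
      show "(norm x)\<^sup>2 - 2 * envelope a \<eta> x \<le> (norm x)\<^sup>2 - 2 * (a i \<bullet> x - \<eta> $ i)" for i
        by (intro diff_left_mono mult_left_mono envelope_ge) simp
    qed simp
  qed
qed

lemma c_transform_le: "c_transform a \<psi> x \<le> cost x (a i) - \<psi> (a i)"
  unfolding c_transform_def by (intro cINF_lower) auto

lemma cell_disjoint: "i \<noteq> j \<Longrightarrow> cell D a \<xi> i \<inter> cell D a \<xi> j = {}"
  by (auto simp: cell_def) (metis less_asym)

lemma open_cell: "open (cell D a \<xi> i)"
proof -
  have "cell D a \<xi> i = interior D \<inter> (\<Inter>j\<in>-{i}. {x. a i \<bullet> x - \<xi> $ i > a j \<bullet> x - \<xi> $ j})"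
    by (auto simp: cell_def)
  also have "open \<dots>"
    by (intro open_Int open_INT) (auto intro!: open_Collect_less continuous_intros)
  finally show ?thesis .
qed

lemma cell_subset: "cell D a \<xi> i \<subseteq> D"
  using interior_subset by (auto simp: cell_def)

lemma sum_indicator_cell:
  assumes "x \<in> cell D a \<xi> i"
  shows "(\<Sum>j\<in>UNIV. indicator (cell D a \<xi> j) x * f j) = (f i :: real)"
proof -
  have "indicator (cell D a \<xi> j) x * f j = (if j = i then f i else 0)" for j
    using assms cell_disjoint[of i j D a \<xi>] by (auto simp: indicator_def)
  then show ?thesis by simp
qed

text \<open>
  A finite source measure enters the analysis of the cells only through two properties: the boundary of
  \<open>D\<close> has measure 0, and strips orthogonal to the differences of the points have a measure at most
  proportional to their width. Since strips may have width 0, ties between two points have measure 0.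
\<close>

locale semidiscrete = finite_measure ud
  for a :: "'n::finite \<Rightarrow> real^2" and D :: "(real^2) set" and ud :: "(real^2) measure" and M :: real +
  assumes inj_a: "inj a"
    and compact_D: "compact D"
    and sets_ud: "sets ud = sets (restrict_space borel D)"
    and frontier_null: "measure ud (D - interior D) = 0"
    and M: "M > 0"
    and strip: "\<And>i j p q. i \<noteq> j \<Longrightarrow> p \<le> q \<Longrightarrow>
      measure ud {x \<in> D. p \<le> (a i - a j) \<bullet> x \<and> (a i - a j) \<bullet> x \<le> q} \<le> M * (q - p)"
begin

abbreviation "C \<equiv> cell D a"
abbreviation "U \<equiv> u_tilde D ud a"

lemma space_ud: "space ud = D"
  using sets_eq_imp_space_eq[OF sets_ud] by (simp add: space_restrict_space)

lemma closed_D: "closed D" using compact_D by (rule compact_imp_closed)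

lemma sets_udI: "B \<in> sets borel \<Longrightarrow> B \<subseteq> D \<Longrightarrow> B \<in> sets ud"
  using closed_D by (simp add: sets_ud sets_restrict_space_iff)

lemma sets_ud_borel: "B \<in> sets ud \<Longrightarrow> B \<in> sets borel"
  using closed_D by (simp add: sets_ud sets_restrict_space_iff)

lemma measurable_udI: "f \<in> measurable borel N \<Longrightarrow> f \<in> measurable ud N"
  by (subst measurable_cong_sets[OF sets_ud refl]) (rule measurable_restrict_space1)

lemma cell_sets [simp, measurable]: "C \<xi> i \<in> sets ud"
  by (intro sets_udI cell_subset borel_open open_cell)

lemma AE_cell: "AE x in ud. \<exists>i. x \<in> C \<xi> i"
proof -
  have closed_strip: "{x \<in> D. p \<le> w \<bullet> x \<and> w \<bullet> x \<le> q} \<in> sets ud" for p q and w :: "real^2"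
  proof (rule sets_udI)
    have "closed ({x. p \<le> w \<bullet> x} \<inter> {x. w \<bullet> x \<le> q})"
      by (intro closed_Int closed_Collect_le continuous_intros)
    moreover have "{x \<in> D. p \<le> w \<bullet> x \<and> w \<bullet> x \<le> q} = D \<inter> ({x. p \<le> w \<bullet> x} \<inter> {x. w \<bullet> x \<le> q})" by auto
    ultimately show "{x \<in> D. p \<le> w \<bullet> x \<and> w \<bullet> x \<le> q} \<in> sets borel" using closed_D by simp
  qed auto
  have "AE x in ud. x \<notin> D - interior D"
    using frontier_null closed_D by (intro AE_not_in null_setsI) (auto simp: emeasure_eq_measure intro!: sets_udI)
  moreover have "AE x in ud. \<forall>i j. i \<noteq> j \<longrightarrow> (a i - a j) \<bullet> x \<noteq> \<xi> $ i - \<xi> $ j"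
  proof (intro AE_all_countable[THEN iffD2] allI)
    fix i j :: 'n
    show "AE x in ud. i \<noteq> j \<longrightarrow> (a i - a j) \<bullet> x \<noteq> \<xi> $ i - \<xi> $ j"
    proof (cases "i = j")
      case False
      let ?S = "{x \<in> D. \<xi> $ i - \<xi> $ j \<le> (a i - a j) \<bullet> x \<and> (a i - a j) \<bullet> x \<le> \<xi> $ i - \<xi> $ j}"
      have "measure ud ?S = 0"
        using strip[OF False order_refl[of "\<xi> $ i - \<xi> $ j"]] measure_nonneg[of ud ?S] by simp
      then have "AE x in ud. x \<notin> ?S"
        by (intro AE_not_in null_setsI closed_strip) (simp add: emeasure_eq_measure)
      then show ?thesis using AE_space by eventually_elim (auto simp: space_ud)
    qed simp
  qed
  ultimately show ?thesis using AE_space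
  proof eventually_elim
    case (elim x)
    obtain i where i: "envelope a \<xi> x = a i \<bullet> x - \<xi> $ i" by (rule envelope_attained)
    have "a j \<bullet> x - \<xi> $ j < a i \<bullet> x - \<xi> $ i" if "j \<noteq> i" for j
    proof -
      have "a j \<bullet> x - \<xi> $ j \<le> a i \<bullet> x - \<xi> $ i" using envelope_ge[of a j x \<xi>] i by simp
      moreover have "(a i - a j) \<bullet> x \<noteq> \<xi> $ i - \<xi> $ j" using elim(2) that by metis
      ultimately show ?thesis by (simp add: inner_diff_left)
    qed
    then show ?case using elim by (auto simp: cell_def space_ud)
  qed
qed

lemma measure_eq_sum_cells:
  assumes A: "A \<in> sets ud"
  shows "measure ud A = (\<Sum>i\<in>UNIV. measure ud (A \<inter> C \<xi> i))"
proof -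
  have "measure ud A = measure ud (\<Union>i. A \<inter> C \<xi> i)"
    using AE_cell[of \<xi>] A by (intro finite_measure_eq_AE) (auto elim!: eventually_mono)
  also have "\<dots> = (\<Sum>i\<in>UNIV. measure ud (A \<inter> C \<xi> i))"
    using A cell_disjoint[of _ _ D a \<xi>]
    by (intro finite_measure_finite_Union) (auto simp: disjoint_family_on_def)
  finally show ?thesis .
qed

text \<open>
  The mass of the points that belong to cell \<open>i\<close> for \<open>\<xi>\<close> and to cell \<open>j\<close> for \<open>\<eta>\<close>; the vectors
  \<open>U \<xi>\<close> and \<open>U \<eta>\<close> are the marginals of this matrix.
\<close>

definition moved :: "real^'n \<Rightarrow> real^'n \<Rightarrow> 'n \<Rightarrow> 'n \<Rightarrow> real" where
  "moved \<xi> \<eta> i j = measure ud (C \<xi> i \<inter> C \<eta> j)"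

lemma U_eq_sum_moved:
  "U \<xi> $ i = (\<Sum>j\<in>UNIV. moved \<xi> \<eta> i j)" "U \<eta> $ j = (\<Sum>i\<in>UNIV. moved \<xi> \<eta> i j)"
  using measure_eq_sum_cells[of "C \<xi> i" \<eta>] measure_eq_sum_cells[of "C \<eta> j" \<xi>]
  by (simp_all add: u_tilde_def moved_def Int_commute)

text \<open>
  A point of both cells satisfies \<open>\<xi> i - \<xi> j < (a i - a j) \<bullet> x < \<eta> i - \<eta> j\<close>. If the cells meet, then
  the moved mass is therefore at most \<open>M\<close> times the difference of these two bounds.
\<close>

lemma moved_bound:
  assumes "i \<noteq> j"
  shows "(moved \<xi> \<eta> i j)\<^sup>2 \<le> M * (moved \<xi> \<eta> i j * ((\<eta> - \<xi>) $ i - (\<eta> - \<xi>) $ j))"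
proof (cases "C \<xi> i \<inter> C \<eta> j = {}")
  case True
  then show ?thesis by (simp add: moved_def)
next
  case False
  have in_strip: "\<xi> $ i - \<xi> $ j < (a i - a j) \<bullet> x" "(a i - a j) \<bullet> x < \<eta> $ i - \<eta> $ j"
    if "x \<in> C \<xi> i \<inter> C \<eta> j" for x
    using that assms by (auto simp: cell_def inner_diff_left algebra_simps)
  then have le: "\<xi> $ i - \<xi> $ j \<le> \<eta> $ i - \<eta> $ j" using False by fastforce
  let ?S = "{x \<in> D. \<xi> $ i - \<xi> $ j \<le> (a i - a j) \<bullet> x \<and> (a i - a j) \<bullet> x \<le> \<eta> $ i - \<eta> $ j}"
  have "closed ({x. \<xi> $ i - \<xi> $ j \<le> (a i - a j) \<bullet> x} \<inter> {x. (a i - a j) \<bullet> x \<le> \<eta> $ i - \<eta> $ j})"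
    by (intro closed_Int closed_Collect_le continuous_intros)
  moreover have "?S = D \<inter> ({x. \<xi> $ i - \<xi> $ j \<le> (a i - a j) \<bullet> x} \<inter> {x. (a i - a j) \<bullet> x \<le> \<eta> $ i - \<eta> $ j})" by auto
  ultimately have "?S \<in> sets ud" using closed_D by (intro sets_udI) auto
  moreover have "C \<xi> i \<inter> C \<eta> j \<subseteq> ?S"
    using in_strip cell_subset[of D a \<xi> i] by (fastforce intro: less_imp_le)
  ultimately have "moved \<xi> \<eta> i j \<le> measure ud ?S"
    unfolding moved_def by (intro finite_measure_mono)
  also have "\<dots> \<le> M * ((\<eta> $ i - \<eta> $ j) - (\<xi> $ i - \<xi> $ j))" by (rule strip[OF assms le])
  finally have "moved \<xi> \<eta> i j \<le> M * ((\<eta> - \<xi>) $ i - (\<eta> - \<xi>) $ j)" by (simp add: algebra_simps)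
  then have "moved \<xi> \<eta> i j * moved \<xi> \<eta> i j \<le> moved \<xi> \<eta> i j * (M * ((\<eta> - \<xi>) $ i - (\<eta> - \<xi>) $ j))"
    by (rule mult_left_mono) (simp add: moved_def)
  then show ?thesis by (simp only: power2_eq_square mult_ac)
qed

definition exchanged :: "real^'n \<Rightarrow> real^'n \<Rightarrow> 'n \<Rightarrow> 'n \<Rightarrow> real" where
  "exchanged \<xi> \<eta> i j = (if i = j then 0 else moved \<xi> \<eta> i j)"

lemma U_diff: "(U \<eta> - U \<xi>) $ i = (\<Sum>j\<in>UNIV. exchanged \<xi> \<eta> j i - exchanged \<xi> \<eta> i j)"
proof -
  have "(U \<eta> - U \<xi>) $ i = (\<Sum>j\<in>UNIV. moved \<xi> \<eta> j i - moved \<xi> \<eta> i j)"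
    using U_eq_sum_moved(1)[of \<xi> i \<eta>] U_eq_sum_moved(2)[of \<eta> i \<xi>] by (simp add: sum_subtractf)
  also have "\<dots> = (\<Sum>j\<in>UNIV. exchanged \<xi> \<eta> j i - exchanged \<xi> \<eta> i j)"
    by (intro sum.cong) (auto simp: exchanged_def)
  finally show ?thesis .
qed

lemma U_diff_inner:
  "- ((U \<eta> - U \<xi>) \<bullet> d) = (\<Sum>i\<in>UNIV. \<Sum>j\<in>UNIV. exchanged \<xi> \<eta> i j * (d $ i - d $ j))"
proof -
  have "(U \<eta> - U \<xi>) \<bullet> d = (\<Sum>i\<in>UNIV. \<Sum>j\<in>UNIV. exchanged \<xi> \<eta> j i * d $ i) - (\<Sum>i\<in>UNIV. \<Sum>j\<in>UNIV. exchanged \<xi> \<eta> i j * d $ i)"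
    by (simp only: inner_vec_def U_diff inner_real_def sum_distrib_right sum_subtractf[symmetric] left_diff_distrib)
  also have "(\<Sum>i\<in>UNIV. \<Sum>j\<in>UNIV. exchanged \<xi> \<eta> j i * d $ i) = (\<Sum>i\<in>UNIV. \<Sum>j\<in>UNIV. exchanged \<xi> \<eta> i j * d $ j)"
    by (rule sum.swap)
  finally show ?thesis by (simp add: right_diff_distrib sum_subtractf)
qed

text \<open>
  By the marginal property, the right-hand side is the sum of the moved masses weighted by
  \<open>(\<eta> - \<xi>) i - (\<eta> - \<xi>) j\<close>, and each term dominates the square of the moved mass divided by \<open>M\<close>. A
  component of \<open>U \<eta> - U \<xi>\<close> is a sum of \<open>CARD('n)\<close> differences of moved masses, so by Cauchy-Schwarz the sum
  of these squares controls the left-hand side.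
\<close>

lemma U_cocoercive:
  "1 / (2 * CARD('n) * M) * (norm (U \<eta> - U \<xi>))\<^sup>2 \<le> - ((U \<eta> - U \<xi>) \<bullet> (\<eta> - \<xi>))"
proof -
  let ?s = "exchanged \<xi> \<eta>" and ?N = "real CARD('n)"
  define Q where "Q = (\<Sum>i\<in>UNIV. \<Sum>j\<in>UNIV. (?s i j)\<^sup>2)"
  have exchanged_nonneg: "?s i j \<ge> 0" for i j by (simp add: exchanged_def moved_def)
  have "(norm (U \<eta> - U \<xi>))\<^sup>2 = (\<Sum>i\<in>UNIV. ((U \<eta> - U \<xi>) $ i)\<^sup>2)"
    unfolding power2_norm_eq_inner inner_vec_def by (simp add: power2_eq_square)
  also have "\<dots> \<le> (\<Sum>i\<in>UNIV. ?N * (\<Sum>j\<in>UNIV. (?s j i)\<^sup>2 + (?s i j)\<^sup>2))"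
  proof (rule sum_mono)
    fix i
    have "((U \<eta> - U \<xi>) $ i)\<^sup>2 \<le> (\<Sum>j\<in>(UNIV::'n set). 1\<^sup>2) * (\<Sum>j\<in>UNIV. (?s j i - ?s i j)\<^sup>2)"
      unfolding U_diff using Cauchy_Schwarz_ineq_sum[of "\<lambda>_. 1" "\<lambda>j. ?s j i - ?s i j" UNIV] by simp
    also have "\<dots> \<le> ?N * (\<Sum>j\<in>UNIV. (?s j i)\<^sup>2 + (?s i j)\<^sup>2)"
    proof -
      have "(?s j i - ?s i j)\<^sup>2 \<le> (?s j i)\<^sup>2 + (?s i j)\<^sup>2" for j
        using exchanged_nonneg by (simp add: power2_diff)
      then show ?thesis by (simp add: sum_mono mult_left_mono)
    qed
    finally show "((U \<eta> - U \<xi>) $ i)\<^sup>2 \<le> ?N * (\<Sum>j\<in>UNIV. (?s j i)\<^sup>2 + (?s i j)\<^sup>2)" .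
  qed
  also have "\<dots> = ?N * (2 * Q)"
  proof -
    have "(\<Sum>i\<in>UNIV. \<Sum>j\<in>UNIV. (?s j i)\<^sup>2) = Q" unfolding Q_def by (rule sum.swap)
    then show ?thesis by (simp add: sum_distrib_left[symmetric] sum.distrib Q_def)
  qed
  also have "Q \<le> M * - ((U \<eta> - U \<xi>) \<bullet> (\<eta> - \<xi>))"
    unfolding U_diff_inner Q_def sum_distrib_left
  proof (intro sum_mono)
    fix i j
    show "(?s i j)\<^sup>2 \<le> M * (?s i j * ((\<eta> - \<xi>) $ i - (\<eta> - \<xi>) $ j))"
      using moved_bound[of i j \<xi> \<eta>] by (cases "i = j") (simp_all add: exchanged_def)
  qed
  finally have "(norm (U \<eta> - U \<xi>))\<^sup>2 \<le> ?N * (2 * (M * - ((U \<eta> - U \<xi>) \<bullet> (\<eta> - \<xi>))))"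
    by (simp add: mult_left_mono)
  then show ?thesis using M by (simp add: field_simps)
qed

lemma bounded_range_U: "bounded (range U)"
proof -
  have "norm (U \<xi>) \<le> (\<Sum>i\<in>(UNIV::'n set). measure ud (space ud))" for \<xi>
  proof -
    have "norm (U \<xi>) \<le> (\<Sum>i\<in>UNIV. \<bar>U \<xi> $ i\<bar>)" by (rule norm_le_l1_cart)
    also have "\<dots> \<le> (\<Sum>i\<in>(UNIV::'n set). measure ud (space ud))"
      by (intro sum_mono) (simp add: u_tilde_def bounded_measure)
    finally show ?thesis .
  qed
  then show ?thesis unfolding bounded_iff by blast
qed

lemma integrable_bounded_on_D:
  assumes "f \<in> borel_measurable borel" "\<And>x. x \<in> D \<Longrightarrow> \<bar>f x\<bar> \<le> B"
  shows "integrable ud (f :: real^2 \<Rightarrow> real)"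
  using assms by (intro integrable_const_bound[where B=B] measurable_udI AE_I2) (auto simp: space_ud)

lemma bounded_radius: obtains R where "R \<ge> 0" "\<And>x. x \<in> D \<Longrightarrow> norm x \<le> R" "\<And>i. norm (a i) \<le> R"
proof -
  have "bounded (D \<union> range a)" using compact_D by (simp add: compact_imp_bounded finite_imp_bounded)
  then obtain R where "R > 0" "\<forall>x\<in>D \<union> range a. norm x \<le> R" by (auto simp only: bounded_pos)
  then show ?thesis using that[of R] by auto
qed

lemma integrable_envelope: "integrable ud (envelope a \<xi>)"
proof -
  obtain R where R: "R \<ge> 0" "\<And>x. x \<in> D \<Longrightarrow> norm x \<le> R" "\<And>i. norm (a i) \<le> R" using bounded_radius by blast
  have "\<bar>envelope a \<xi> x\<bar> \<le> R * R + norm \<xi>" if x: "x \<in> D" for x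
  proof -
    obtain i where i: "envelope a \<xi> x = a i \<bullet> x - \<xi> $ i" by (rule envelope_attained)
    have "\<bar>a i \<bullet> x\<bar> \<le> norm (a i) * norm x" by (rule Cauchy_Schwarz_ineq2)
    also have "\<dots> \<le> R * R" using R x by (intro mult_mono) auto
    finally show ?thesis unfolding i using component_le_norm_cart[of \<xi> i] by linarith
  qed
  then show ?thesis by (intro integrable_bounded_on_D) auto
qed

lemma integrable_cell_sum:
  "integrable ud (\<lambda>x. \<Sum>i\<in>UNIV. indicator (C \<xi> i) x * (f i :: real))"
  by (intro Bochner_Integration.integrable_sum Bochner_Integration.integrable_mult_left integrable_real_indicator) (auto simp: emeasure_eq_measure)

lemma integral_cell_sum:
  "(\<integral>x. (\<Sum>i\<in>UNIV. indicator (C \<xi> i) x * f i) \<partial>ud) = (\<Sum>i\<in>UNIV. U \<xi> $ i * (f i :: real))"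
proof -
  have "C \<xi> i \<inter> space ud = C \<xi> i" for i using cell_subset[of D a \<xi> i] by (auto simp: space_ud)
  then show ?thesis
    by (subst Bochner_Integration.integral_sum) (auto simp: u_tilde_def emeasure_eq_measure)
qed

definition dual :: "real^'n \<Rightarrow> real" where
  "dual \<xi> = (\<integral>x. envelope a \<xi> x \<partial>ud)"

text \<open>
  Almost every \<open>x\<close> lies in a cell \<open>i\<close> of \<open>\<xi>\<close>, where \<open>envelope a \<xi> x - (\<eta> - \<xi>) i = a i \<bullet> x - \<eta> i\<close>; this is
  one of the values maximised in \<open>envelope a \<eta> x\<close>.
\<close>

lemma dual_subgradient: "dual \<eta> \<ge> dual \<xi> - U \<xi> \<bullet> (\<eta> - \<xi>)"
proof -
  have "dual \<xi> - U \<xi> \<bullet> (\<eta> - \<xi>) =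
      (\<integral>x. envelope a \<xi> x - (\<Sum>i\<in>UNIV. indicator (C \<xi> i) x * (\<eta> - \<xi>) $ i) \<partial>ud)"
    unfolding Bochner_Integration.integral_diff[OF integrable_envelope integrable_cell_sum]
      integral_cell_sum dual_def inner_vec_def inner_real_def ..
  also have "\<dots> \<le> dual \<eta>"
    unfolding dual_def
  proof (rule integral_mono_AE)
    show "AE x in ud. envelope a \<xi> x - (\<Sum>i\<in>UNIV. indicator (C \<xi> i) x * (\<eta> - \<xi>) $ i) \<le> envelope a \<eta> x"
      using AE_cell[of \<xi>]
    proof eventually_elim
      case (elim x)
      then obtain i where i: "x \<in> C \<xi> i" by blast
      show ?case
        using envelope_ge[of a i x \<eta>] by (simp only: envelope_on_cell[OF i] sum_indicator_cell[OF i]) simp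
    qed
  qed (intro Bochner_Integration.integrable_diff integrable_envelope integrable_cell_sum)+
  finally show ?thesis .
qed

section \<open>Optimal potentials\<close>

lemma integrable_c_transform:
  assumes "\<And>i. \<psi> (a i) = (norm (a i))\<^sup>2 - 2 * \<eta> $ i"
  shows "integrable ud (c_transform a \<psi>)"
proof -
  obtain R where "\<And>x. x \<in> D \<Longrightarrow> norm x \<le> R"
    using compact_imp_bounded[OF compact_D] by (auto simp: bounded_iff)
  then have "\<bar>(norm x)\<^sup>2\<bar> \<le> R\<^sup>2" if "x \<in> D" for x
    using that power_mono[of "norm x" R 2] by simp
  then have "integrable ud (\<lambda>x. (norm x)\<^sup>2)"
    by (intro integrable_bounded_on_D[where B="R\<^sup>2"]) auto
  then have "integrable ud (\<lambda>x. (norm x)\<^sup>2 - 2 * envelope a \<eta> x)"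
    by (rule Bochner_Integration.integrable_diff) (intro integrable_mult_right integrable_envelope)
  moreover have "c_transform a \<psi> = (\<lambda>x. (norm x)\<^sup>2 - 2 * envelope a \<eta> x)"
    by (rule ext) (rule c_transform_eq_envelope[OF assms])
  ultimately show ?thesis by simp
qed

text \<open>
  Integrate \<open>c_transform a \<psi> x + \<psi> y \<le> cost x y\<close> against a coupling. The first marginal is identified as
  an image measure; the second is evaluated on the slices \<open>D \<times> {a i}\<close>.
\<close>

lemma weak_duality:
  assumes \<gamma>: "\<gamma> \<in> couplings D ud a u" and int: "integrable ud (c_transform a \<psi>)"
  shows "ennreal ((\<integral>x. c_transform a \<psi> x \<partial>ud) + (\<Sum>i\<in>UNIV. \<psi> (a i) * u $ i))
    \<le> (\<integral>\<^sup>+ p. ennreal (cost (fst p) (snd p)) \<partial>\<gamma>)"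
proof -
  have sets_\<gamma>: "sets \<gamma> = sets (restrict_space borel (D \<times> range a))"
    and marg1: "\<And>B. B \<in> sets ud \<Longrightarrow> emeasure \<gamma> (B \<times> range a) = emeasure ud B"
    and marg2: "\<And>E. E \<subseteq> range a \<Longrightarrow> enn2ereal (emeasure \<gamma> (D \<times> E)) = ereal (signed_meas a u E)"
    using \<gamma> by (auto simp: couplings_def sets_ud)
  have space_\<gamma>: "space \<gamma> = D \<times> range a"
    using sets_eq_imp_space_eq[OF sets_\<gamma>] by (simp add: space_restrict_space)
  have meas_\<gamma>: "f \<in> measurable \<gamma> N" if "f \<in> measurable borel N" for f :: "(real^2) \<times> (real^2) \<Rightarrow> 'z" and N
    using that by (subst measurable_cong_sets[OF sets_\<gamma> refl]) (rule measurable_restrict_space1)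
  have "closed (range a)" by (simp add: finite_imp_closed)
  then have closed_\<gamma>: "closed (D \<times> range a)" using closed_D by (intro closed_Times)
  have "emeasure \<gamma> (space \<gamma>) = emeasure ud D"
    using marg1[of D] sets.top[of ud] by (simp add: space_\<gamma> space_ud)
  then interpret \<gamma>: finite_measure \<gamma> by (intro finite_measureI) (simp add: emeasure_eq_measure)
  have fst_meas: "fst \<in> measurable \<gamma> ud"
  proof -
    have "fst \<in> borel_measurable \<gamma>" by (intro meas_\<gamma> borel_measurable_continuous_onI continuous_intros)
    then have "fst \<in> measurable \<gamma> (restrict_space borel D)"
      by (rule measurable_restrict_space2[rotated]) (auto simp: space_\<gamma>)
    then show ?thesis by (subst measurable_cong_sets[OF refl sets_ud])
  qed
  have distr_fst: "distr \<gamma> ud fst = ud"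
  proof (rule measure_eqI)
    fix B assume "B \<in> sets (distr \<gamma> ud fst)"
    then have B: "B \<in> sets ud" by simp
    then have "B \<subseteq> D" using sets.sets_into_space[of B ud] by (simp add: space_ud)
    then have "fst -` B \<inter> space \<gamma> = B \<times> range a" by (auto simp: space_\<gamma>)
    then show "emeasure (distr \<gamma> ud fst) B = emeasure ud B"
      using marg1[OF B] by (simp add: emeasure_distr[OF fst_meas B])
  qed simp
  define w where "w p = (\<Sum>i\<in>UNIV. indicator (D \<times> {a i}) p * \<psi> (a i))" for p :: "(real^2) \<times> (real^2)"
  have slice: "D \<times> {a i} \<in> sets \<gamma>" for i
    using closed_D closed_\<gamma> by (auto simp: sets_\<gamma> sets_restrict_space_iff intro!: borel_closed closed_Times)
  have measure_slice: "measure \<gamma> (D \<times> {a i}) = u $ i" for i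
  proof -
    have "signed_meas a u {a i} = (\<Sum>j\<in>UNIV. if j = i then u $ j else 0)"
      unfolding signed_meas_def using inj_a by (intro sum.cong) (auto simp: inj_eq)
    then have "enn2ereal (emeasure \<gamma> (D \<times> {a i})) = ereal (u $ i)" using marg2[of "{a i}"] by simp
    then show ?thesis by (simp add: measure_def enn2real_def)
  qed
  have w_int: "integrable \<gamma> w"
    unfolding w_def using slice
    by (intro Bochner_Integration.integrable_sum Bochner_Integration.integrable_mult_left integrable_real_indicator)
       (auto simp: \<gamma>.emeasure_eq_measure)
  have "(\<integral>p. w p \<partial>\<gamma>) = (\<Sum>i\<in>UNIV. \<psi> (a i) * u $ i)"
  proof -
    have "D \<times> {a i} \<inter> space \<gamma> = D \<times> {a i}" for i by (auto simp: space_\<gamma>)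
    then show ?thesis
      unfolding w_def using slice
      by (subst Bochner_Integration.integral_sum) (auto simp: measure_slice \<gamma>.emeasure_eq_measure mult.commute)
  qed
  moreover have "(\<integral>x. c_transform a \<psi> x \<partial>ud) = (\<integral>p. c_transform a \<psi> (fst p) \<partial>\<gamma>)"
    using integral_distr[OF fst_meas, of "c_transform a \<psi>"] int by (simp add: distr_fst)
  moreover have int': "integrable \<gamma> (\<lambda>p. c_transform a \<psi> (fst p))"
    using integrable_distr_eq[OF fst_meas, of "c_transform a \<psi>"] int by (simp add: distr_fst)
  ultimately have "(\<integral>x. c_transform a \<psi> x \<partial>ud) + (\<Sum>i\<in>UNIV. \<psi> (a i) * u $ i) = (\<integral>p. c_transform a \<psi> (fst p) + w p \<partial>\<gamma>)"
    using w_int by simp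
  also have cost_int: "integrable \<gamma> (\<lambda>p. cost (fst p) (snd p))"
  proof -
    obtain R where R: "R \<ge> 0" "\<And>x. x \<in> D \<Longrightarrow> norm x \<le> R" "\<And>i. norm (a i) \<le> R" using bounded_radius by blast
    have "norm (cost (fst p) (snd p)) \<le> (R + R)\<^sup>2" if "p \<in> space \<gamma>" for p
    proof -
      have "norm (fst p - snd p) \<le> R + R"
        using that R by (intro order_trans[OF norm_triangle_ineq4] add_mono) (auto simp: space_\<gamma>)
      then have "(norm (fst p - snd p))\<^sup>2 \<le> (R + R)\<^sup>2" by (rule power_mono) simp
      then show ?thesis by (simp add: cost_def)
    qed
    then show ?thesis
      by (intro \<gamma>.integrable_const_bound[where B="(R + R)\<^sup>2"] AE_I2 meas_\<gamma>)
         (auto simp: cost_def intro!: borel_measurable_continuous_onI continuous_intros)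
  qed
  have "(\<integral>p. c_transform a \<psi> (fst p) + w p \<partial>\<gamma>) \<le> (\<integral>p. cost (fst p) (snd p) \<partial>\<gamma>)"
  proof (rule integral_mono)
    fix p assume "p \<in> space \<gamma>"
    then obtain x i where p: "p = (x, a i)" "x \<in> D" by (auto simp: space_\<gamma>)
    have "w p = (\<Sum>j\<in>UNIV. if j = i then \<psi> (a i) else 0)"
      unfolding w_def using inj_a p by (intro sum.cong) (auto simp: inj_eq)
    then show "c_transform a \<psi> (fst p) + w p \<le> cost (fst p) (snd p)"
      using c_transform_le[of a \<psi> x i] by (simp add: p)
  qed (use int' w_int cost_int in auto)
  finally have "(\<integral>x. c_transform a \<psi> x \<partial>ud) + (\<Sum>i\<in>UNIV. \<psi> (a i) * u $ i) \<le> (\<integral>p. cost (fst p) (snd p) \<partial>\<gamma>)" .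
  moreover have "(\<integral>\<^sup>+ p. ennreal (cost (fst p) (snd p)) \<partial>\<gamma>) = ennreal (\<integral>p. cost (fst p) (snd p) \<partial>\<gamma>)"
    using cost_int by (intro nn_integral_eq_integral) (auto simp: cost_def)
  ultimately show ?thesis by (simp add: ennreal_leI)
qed

text \<open>
  Off the cells the map takes an arbitrary value in the range of \<open>a\<close>, so that its graph over \<open>D\<close> lies in
  the space of the couplings.
\<close>

definition transport :: "real^'n \<Rightarrow> real^2 \<Rightarrow> real^2" where
  "transport \<eta> x = (if \<exists>i. x \<in> C \<eta> i then a (SOME i. x \<in> C \<eta> i) else a undefined)"

lemma transport_on_cell: "x \<in> C \<eta> i \<Longrightarrow> transport \<eta> x = a i"
proof -
  assume x: "x \<in> C \<eta> i"
  then have "(SOME j. x \<in> C \<eta> j) = i" using cell_disjoint[of _ i D a \<eta>] by (intro some_equality) blast+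
  then show ?thesis using x by (auto simp: transport_def)
qed

lemma transport_in_range: "transport \<eta> x \<in> range a"
  by (auto simp: transport_def)

lemma measurable_transport: "transport \<eta> \<in> borel_measurable borel"
proof -
  have eq: "transport \<eta> x = a undefined + (\<Sum>i\<in>UNIV. indicator (C \<eta> i) x *\<^sub>R (a i - a undefined))" for x
  proof (cases "\<exists>i. x \<in> C \<eta> i")
    case True
    then obtain i where i: "x \<in> C \<eta> i" by blast
    have "indicator (C \<eta> j) x *\<^sub>R (a j - a undefined) = (if j = i then a i - a undefined else 0)" for j
      using i cell_disjoint[of i j D a \<eta>] by (auto simp: indicator_def)
    then show ?thesis by (simp add: transport_on_cell[OF i])
  next
    case False
    then show ?thesis by (simp add: transport_def)
  qed
  have "(\<lambda>x. a undefined + (\<Sum>i\<in>UNIV. indicator (C \<eta> i) x *\<^sub>R (a i - a undefined))) \<in> borel_measurable borel"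
    by (intro borel_measurable_add borel_measurable_sum borel_measurable_scaleR borel_measurable_indicator
        borel_measurable_const borel_open open_cell)
  then show ?thesis unfolding eq[symmetric] .
qed

definition plan :: "real^'n \<Rightarrow> ((real^2) \<times> (real^2)) measure" where
  "plan \<eta> = distr ud (restrict_space borel (D \<times> range a)) (\<lambda>x. (x, transport \<eta> x))"

lemma measurable_graph: "(\<lambda>x. (x, transport \<eta> x)) \<in> measurable ud (restrict_space borel (D \<times> range a))"
proof (rule measurable_restrict_space2)
  show "(\<lambda>x. (x, transport \<eta> x)) \<in> space ud \<rightarrow> D \<times> range a"
    using transport_in_range by (auto simp: space_ud)
  show "(\<lambda>x. (x, transport \<eta> x)) \<in> borel_measurable ud"
    using measurable_transport by (intro measurable_udI borel_measurable_Pair) auto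
qed

lemma emeasure_transport:
  assumes "E \<subseteq> range a"
  shows "emeasure ud {x \<in> D. transport \<eta> x \<in> E} = ennreal (signed_meas a (U \<eta>) E)"
proof -
  have "finite E" using assms by (rule finite_subset) simp
  then have "E \<in> sets borel" by (intro borel_closed finite_imp_closed)
  then have "transport \<eta> -` E \<inter> space borel \<in> sets borel" by (rule measurable_sets[OF measurable_transport])
  then have "D \<inter> transport \<eta> -` E \<in> sets borel" using closed_D by auto
  moreover have "{x \<in> D. transport \<eta> x \<in> E} = D \<inter> transport \<eta> -` E" by auto
  ultimately have S: "{x \<in> D. transport \<eta> x \<in> E} \<in> sets ud" by (intro sets_udI) auto
  have "measure ud ({x \<in> D. transport \<eta> x \<in> E} \<inter> C \<eta> i) = U \<eta> $ i * indicator E (a i)" for i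
  proof -
    have "{x \<in> D. transport \<eta> x \<in> E} \<inter> C \<eta> i = (if a i \<in> E then C \<eta> i else {})"
      using cell_subset[of D a \<eta> i] by (auto simp: transport_on_cell)
    then show ?thesis by (simp add: u_tilde_def)
  qed
  then show ?thesis
    by (simp add: emeasure_eq_measure measure_eq_sum_cells[OF S, of \<eta>] signed_meas_def)
qed

lemma plan_coupling: "plan \<eta> \<in> couplings D ud a (U \<eta>)"
  unfolding couplings_def
proof (intro CollectI conjI ballI allI impI)
  show "sets (plan \<eta>) = sets (restrict_space borel (D \<times> range a))" by (simp add: plan_def)
  have closed_range: "closed (range a)" by (simp add: finite_imp_closed)
  have rect: "B \<times> E \<in> sets (restrict_space borel (D \<times> range a))"
    if "B \<in> sets borel" "B \<subseteq> D" "E \<in> sets borel" "E \<subseteq> range a" for B E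
  proof -
    have "B \<times> E \<in> sets borel" using that by (simp add: borel_prod[symmetric])
    moreover have "D \<times> range a \<in> sets borel" using closed_D closed_range by (intro borel_closed closed_Times)
    ultimately show ?thesis using that by (auto simp: sets_restrict_space_iff)
  qed
  fix B assume "B \<in> sets (restrict_space borel D)"
  then have B: "B \<in> sets ud" by (simp add: sets_ud)
  have "B \<subseteq> D" using sets.sets_into_space[OF B] by (simp add: space_ud)
  then have "emeasure (plan \<eta>) (B \<times> range a) = emeasure ud ((\<lambda>x. (x, transport \<eta> x)) -` (B \<times> range a) \<inter> space ud)"
    unfolding plan_def using sets_ud_borel[OF B] closed_range
    by (intro emeasure_distr measurable_graph rect) auto
  also have "(\<lambda>x. (x, transport \<eta> x)) -` (B \<times> range a) \<inter> space ud = B"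
    using \<open>B \<subseteq> D\<close> transport_in_range by (auto simp: space_ud)
  finally show "emeasure (plan \<eta>) (B \<times> range a) = emeasure ud B" .
next
  fix E assume E: "E \<subseteq> range a"
  then have "finite E" by (rule finite_subset) simp
  have "D \<times> E \<in> sets borel" "D \<times> range a \<in> sets borel"
    by (intro borel_closed closed_Times closed_D finite_imp_closed finite_imageI finite \<open>finite E\<close>)+
  then have "emeasure (plan \<eta>) (D \<times> E) = emeasure ud ((\<lambda>x. (x, transport \<eta> x)) -` (D \<times> E) \<inter> space ud)"
    unfolding plan_def using E
    by (intro emeasure_distr measurable_graph) (auto simp: sets_restrict_space_iff)
  also have "(\<lambda>x. (x, transport \<eta> x)) -` (D \<times> E) \<inter> space ud = {x \<in> D. transport \<eta> x \<in> E}"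
    by (auto simp: space_ud)
  finally have "emeasure (plan \<eta>) (D \<times> E) = ennreal (signed_meas a (U \<eta>) E)"
    using emeasure_transport[OF E] by simp
  moreover have "signed_meas a (U \<eta>) E \<ge> 0"
    unfolding signed_meas_def by (intro sum_nonneg) (simp add: u_tilde_def)
  ultimately show "enn2ereal (emeasure (plan \<eta>) (D \<times> E)) = ereal (signed_meas a (U \<eta>) E)"
    by (simp add: enn2ereal_ennreal)
qed

text \<open>
  On cell \<open>i\<close> of \<open>\<eta>\<close> the minimum in the c-transform is attained at \<open>a i\<close>, the point to which the cell is
  sent: the plan attains equality in weak duality.
\<close>

lemma plan_cost:
  assumes \<psi>: "\<And>i. \<psi> (a i) = (norm (a i))\<^sup>2 - 2 * \<eta> $ i"
  defines "v \<equiv> (\<integral>x. c_transform a \<psi> x \<partial>ud) + (\<Sum>i\<in>UNIV. \<psi> (a i) * U \<eta> $ i)"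
  shows "(\<integral>\<^sup>+ p. ennreal (cost (fst p) (snd p)) \<partial>plan \<eta>) = ennreal v" "v \<ge> 0"
proof -
  let ?f = "\<lambda>x. c_transform a \<psi> x + (\<Sum>i\<in>UNIV. indicator (C \<eta> i) x * \<psi> (a i))"
  have AE_cost: "AE x in ud. cost x (transport \<eta> x) = ?f x"
    using AE_cell[of \<eta>]
  proof eventually_elim
    case (elim x)
    then obtain i where i: "x \<in> C \<eta> i" by blast
    have "cost x (a i) - \<psi> (a i) = (norm x)\<^sup>2 - 2 * (a i \<bullet> x - \<eta> $ i)"
      by (simp add: cost_def \<psi> power2_norm_eq_inner inner_diff_left inner_diff_right inner_commute)
    then have "cost x (a i) - \<psi> (a i) = c_transform a \<psi> x"
      unfolding c_transform_eq_envelope[of \<psi> a \<eta> x, OF \<psi>] envelope_on_cell[OF i] .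
    then show ?case unfolding sum_indicator_cell[OF i] transport_on_cell[OF i] by simp
  qed
  have int: "integrable ud ?f"
    by (intro Bochner_Integration.integrable_add integrable_c_transform[of \<psi> \<eta>, OF \<psi>] integrable_cell_sum)
  have v: "v = (\<integral>x. ?f x \<partial>ud)"
    unfolding v_def Bochner_Integration.integral_add[OF integrable_c_transform[OF \<psi>] integrable_cell_sum] integral_cell_sum
    by (simp add: mult.commute)
  have nonneg: "AE x in ud. 0 \<le> ?f x" using AE_cost by eventually_elim (metis cost_def zero_le_power2)
  then show "v \<ge> 0" unfolding v by (rule integral_nonneg_AE)
  have "(\<integral>\<^sup>+ p. ennreal (cost (fst p) (snd p)) \<partial>plan \<eta>) = (\<integral>\<^sup>+ x. ennreal (cost x (transport \<eta> x)) \<partial>ud)"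
    unfolding plan_def
    by (subst nn_integral_distr[OF measurable_graph])
       (auto simp: cost_def intro!: measurable_compose[OF _ measurable_ennreal] measurable_restrict_space1 borel_measurable_continuous_onI continuous_intros)
  also have "\<dots> = (\<integral>\<^sup>+ x. ennreal (?f x) \<partial>ud)"
    using AE_cost by (intro nn_integral_cong_AE) (auto elim: eventually_mono)
  also have "\<dots> = ennreal v"
    unfolding v using int nonneg by (rule nn_integral_eq_integral)
  finally show "(\<integral>\<^sup>+ p. ennreal (cost (fst p) (snd p)) \<partial>plan \<eta>) = ennreal v" .
qed

lemma potential_of_cells:
  assumes \<psi>: "\<And>i. \<psi> (a i) = (norm (a i))\<^sup>2 - 2 * \<eta> $ i"
  shows "\<psi> \<in> potentials D ud a (U \<eta>)"
proof -
  let ?v = "(\<integral>x. c_transform a \<psi> x \<partial>ud) + (\<Sum>i\<in>UNIV. \<psi> (a i) * U \<eta> $ i)"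
  have "(INF \<gamma>\<in>couplings D ud a (U \<eta>). \<integral>\<^sup>+ p. ennreal (cost (fst p) (snd p)) \<partial>\<gamma>) = ennreal ?v"
  proof (rule antisym)
    show "(INF \<gamma>\<in>couplings D ud a (U \<eta>). \<integral>\<^sup>+ p. ennreal (cost (fst p) (snd p)) \<partial>\<gamma>) \<le> ennreal ?v"
      by (rule INF_lower2[OF plan_coupling]) (simp add: plan_cost(1)[OF \<psi>])
    show "ennreal ?v \<le> (INF \<gamma>\<in>couplings D ud a (U \<eta>). \<integral>\<^sup>+ p. ennreal (cost (fst p) (snd p)) \<partial>\<gamma>)"
      by (intro INF_greatest weak_duality integrable_c_transform[of \<psi> \<eta>, OF \<psi>])
  qed
  then have "W22 D ud a (U \<eta>) = ereal ?v"
    unfolding W22_def using plan_cost(2)[OF \<psi>] by (simp add: enn2ereal_ennreal)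
  moreover have "continuous_on (range a) \<psi>" by (intro continuous_on_finite) simp
  ultimately show ?thesis by (simp add: potentials_def integral_signed_def)
qed

end
section \<open>Sources with a bounded density\<close>

text \<open>
  A rotation that takes \<open>w\<close> to the direction of the first axis maps the set into a rectangle with sides
  \<open>(q - p) / |w|\<close> and \<open>2 R\<close>.
\<close>

lemma emeasure_strip:
  fixes w :: "real^2"
  assumes w: "w \<noteq> 0" and R: "R \<ge> 0" and pq: "p \<le> q" and S: "S \<in> sets borel" "S \<subseteq> cball 0 R"
    "\<And>x. x \<in> S \<Longrightarrow> p \<le> w \<bullet> x \<and> w \<bullet> x \<le> q"
  shows "emeasure lborel S \<le> ennreal (2 * R / norm w * (q - p))"
proof -
  have "norm w = norm (norm w *\<^sub>R axis 1 1 :: real^2)" by simp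
  then obtain f :: "real^2 \<Rightarrow> real^2" where f: "orthogonal_transformation f" "f w = norm w *\<^sub>R axis 1 1"
    by (rule orthogonal_transformation_exists)
  have bS: "bounded S" using S(2) bounded_cball bounded_subset by blast
  then have fin: "emeasure lborel S < \<infinity>" by (rule emeasure_bounded_finite)
  have lm: "S \<in> lmeasurable" using S(1) fin by (intro fmeasurableI) auto
  define l u :: "real^2" where "l = vector [p / norm w, - R]" and "u = vector [q / norm w, R]"
  have sub: "f ` S \<subseteq> cbox l u"
  proof
    fix y assume "y \<in> f ` S"
    then obtain x where x: "x \<in> S" "y = f x" by blast
    have "f w \<bullet> f x = w \<bullet> x" using f(1) by (simp add: orthogonal_transformation_def)
    then have "norm w * (y $ 1) = w \<bullet> x" using f(2) x by (simp add: inner_axis')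
    then have 1: "p / norm w \<le> y $ 1" "y $ 1 \<le> q / norm w"
      using S(3)[OF x(1)] w by (auto simp: field_simps)
    have "norm y \<le> R" using x S(2) f(1) by (auto simp: orthogonal_transformation_norm)
    then have "\<bar>y $ 2\<bar> \<le> R" using component_le_norm_cart[of y 2] by linarith
    with 1 show "y \<in> cbox l u" by (auto simp: mem_box_cart forall_2 l_def u_def)
  qed
  have "measure lebesgue S = measure lebesgue (f ` S)"
    by (rule measure_orthogonal_image[OF f(1) lm, symmetric])
  also have "\<dots> \<le> measure lebesgue (cbox l u)"
    using sub measurable_orthogonal_image[OF f(1) lm] by (intro measure_mono_fmeasurable) auto
  also have "\<dots> = (q / norm w - p / norm w) * (2 * R)"
  proof -
    have "\<forall>i. l $ i \<le> u $ i" using pq R w by (simp add: forall_2 l_def u_def divide_right_mono)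
    then have "cbox l u \<noteq> {}" by (simp add: interval_ne_empty_cart)
    then show ?thesis by (simp add: content_cbox_cart UNIV_2 l_def u_def)
  qed
  finally have "measure lborel S \<le> 2 * R / norm w * (q - p)"
    using S(1) by (simp add: diff_divide_distrib algebra_simps)
  then show ?thesis
    using fin by (subst emeasure_eq_ennreal_measure) (auto intro: ennreal_leI)
qed

text \<open>
  The density is bounded by some \<open>B\<close> on the compact set \<open>D\<close>, and the least distance \<open>\<delta>\<close> of two of the
  points is positive, which makes the strip estimate uniform: \<open>M = 2 B R / \<delta>\<close> for \<open>D\<close> in a ball of
  radius \<open>R\<close>.
\<close>

lemma semidiscrete_density:
  fixes a :: "'n::finite \<Rightarrow> real^2"
  assumes inj: "inj a" and D: "compact D" "convex D"
    and \<rho>: "continuous_on D \<rho>"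
    and ud: "ud = density (restrict_space lborel D) (\<lambda>x. ennreal (\<rho> x))"
  obtains M where "semidiscrete a D ud M"
proof -
  have D_borel: "D \<in> sets borel" using D(1) by (simp add: borel_compact)
  obtain B where B: "B > 0" "\<And>x. x \<in> D \<Longrightarrow> \<rho> x \<le> B"
  proof -
    have "bounded (\<rho> ` D)" using \<rho> D(1) by (intro compact_imp_bounded compact_continuous_image)
    then obtain B where "B > 0" "\<forall>y\<in>\<rho> ` D. norm y \<le> B" by (auto simp only: bounded_pos)
    then show ?thesis using that[of B] by (auto simp: abs_le_iff)
  qed
  obtain R where R: "R > 0" "\<And>x. x \<in> D \<Longrightarrow> norm x \<le> R"
    using bounded_pos[THEN iffD1, OF compact_imp_bounded[OF D(1)]] that by blast
  have sets_ud: "sets ud = sets (restrict_space borel D)"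
    by (simp add: ud sets_restrict_space)
  have \<rho>_meas: "(\<lambda>x. ennreal (\<rho> x)) \<in> borel_measurable (restrict_space lborel D)"
  proof -
    have "\<rho> \<in> borel_measurable (restrict_space borel D)" using \<rho> by (rule borel_measurable_continuous_on_restrict)
    moreover have "sets (restrict_space lborel D) = sets (restrict_space (borel :: (real^2) measure) D)" by (simp add: sets_restrict_space)
    ultimately have "\<rho> \<in> borel_measurable (restrict_space lborel D)" by (subst measurable_cong_sets[OF _ refl])
    then show ?thesis by measurable
  qed
  have bound: "emeasure ud S \<le> ennreal B * emeasure lborel S" if S: "S \<in> sets borel" "S \<subseteq> D" for S
  proof -
    have S': "S \<in> sets (restrict_space lborel D)" using S D_borel by (simp add: sets_restrict_space_iff)
    have "emeasure ud S = (\<integral>\<^sup>+ x. ennreal (\<rho> x) * indicator S x \<partial>restrict_space lborel D)"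
      unfolding ud by (rule emeasure_density[OF \<rho>_meas S'])
    also have "\<dots> \<le> (\<integral>\<^sup>+ x. ennreal B * indicator S x \<partial>restrict_space lborel D)"
      by (intro nn_integral_mono mult_right_mono ennreal_leI B) (auto simp: space_restrict_space)
    also have "\<dots> = ennreal B * emeasure (restrict_space lborel D) S"
      using S' by (simp add: nn_integral_cmult_indicator)
    also have "emeasure (restrict_space lborel D) S = emeasure lborel S"
      using S D_borel by (intro emeasure_restrict_space) auto
    finally show ?thesis .
  qed
  have "emeasure ud D \<noteq> \<infinity>"
    using bound[OF D_borel order_refl] emeasure_bounded_finite[OF compact_imp_bounded[OF D(1)]]
    by (auto simp: ennreal_mult_less_top top_unique less_top[symmetric] ennreal_mult_eq_top_iff)
  moreover have "space ud = D" by (simp add: ud space_restrict_space)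
  ultimately interpret finite_measure ud by (intro finite_measureI) simp
  have bound': "measure ud S \<le> B * m"
    if "S \<in> sets borel" "S \<subseteq> D" "emeasure lborel S \<le> ennreal m" "m \<ge> 0" for S m
  proof -
    have "emeasure ud S \<le> ennreal B * ennreal m"
      using bound[OF that(1,2)] that(3) by (meson mult_left_mono order_trans zero_le)
    then have "ennreal (measure ud S) \<le> ennreal (B * m)"
      using B(1) that(4) by (simp add: emeasure_eq_measure ennreal_mult)
    then show ?thesis using B(1) that(4) by (simp add: ennreal_le_iff)
  qed
  \<comment> \<open>the element 1 keeps the set nonempty when there is only one point\<close>
  define \<delta> where "\<delta> = Min (insert 1 ((\<lambda>(i, j). norm (a i - a j)) ` {(i, j). i \<noteq> j}))"
  have \<delta>: "\<delta> > 0" "\<And>i j. i \<noteq> j \<Longrightarrow> \<delta> \<le> norm (a i - a j)"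
  proof -
    have fin: "finite (insert 1 ((\<lambda>(i, j). norm (a i - a j)) ` {(i, j). i \<noteq> j}))" by simp
    have "0 < y" if "y \<in> insert 1 ((\<lambda>(i, j). norm (a i - a j)) ` {(i, j). i \<noteq> j})" for y
      using that inj by (auto simp: inj_eq)
    then show "\<delta> > 0" unfolding \<delta>_def using fin by (subst Min_gr_iff) auto
    show "\<delta> \<le> norm (a i - a j)" if "i \<noteq> j" for i j
      unfolding \<delta>_def using fin that by (intro Min_le) auto
  qed
  have "semidiscrete a D ud (B * (2 * R / \<delta>))"
  proof
    show "B * (2 * R / \<delta>) > 0" using B R \<delta>(1) by simp
    have "D - interior D \<subseteq> frontier D" unfolding frontier_def using closure_subset[of D] by blast
    then have "negligible (D - interior D)"
      by (rule negligible_subset[OF negligible_convex_frontier[OF D(2)]])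
    moreover have diff: "D - interior D \<in> sets borel"
      by (intro sets.Diff D_borel borel_open open_interior)
    ultimately have "emeasure lborel (D - interior D) = 0"
      by (simp add: negligible_iff_emeasure0)
    then have "measure ud (D - interior D) \<le> B * 0"
      by (intro bound' diff) auto
    then show "measure ud (D - interior D) = 0"
      using measure_nonneg[of ud "D - interior D"] by linarith
    fix i j :: 'n and p q :: real assume ij: "i \<noteq> j" and pq: "p \<le> q"
    let ?S = "{x \<in> D. p \<le> (a i - a j) \<bullet> x \<and> (a i - a j) \<bullet> x \<le> q}"
    have "closed ({x. p \<le> (a i - a j) \<bullet> x} \<inter> {x. (a i - a j) \<bullet> x \<le> q})"
      by (intro closed_Int closed_Collect_le continuous_intros)
    moreover have "?S = D \<inter> ({x. p \<le> (a i - a j) \<bullet> x} \<inter> {x. (a i - a j) \<bullet> x \<le> q})" by auto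
    ultimately have S: "?S \<in> sets borel" using D_borel by auto
    have "a i - a j \<noteq> 0" using ij inj by (simp add: inj_eq)
    then have "emeasure lborel ?S \<le> ennreal (2 * R / norm (a i - a j) * (q - p))"
    proof (rule emeasure_strip)
      show "?S \<subseteq> cball 0 R" using R(2) by (simp add: subset_iff)
      show "0 \<le> R" using R(1) by simp
      show "p \<le> (a i - a j) \<bullet> x \<and> (a i - a j) \<bullet> x \<le> q" if "x \<in> ?S" for x using that by simp
    qed (rule pq S)+
    also have "\<dots> \<le> ennreal (2 * R / \<delta> * (q - p))"
    proof (intro ennreal_leI mult_right_mono divide_left_mono)
      show "0 < norm (a i - a j) * \<delta>" using \<open>a i - a j \<noteq> 0\<close> \<delta>(1) by simp
    qed (use \<delta>(2)[OF ij] R(1) pq in simp_all)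
    finally have "measure ud ?S \<le> B * (2 * R / \<delta> * (q - p))"
      by (rule bound'[OF S, rotated]) (use R(1) \<delta>(1) pq in simp_all)
    then show "measure ud ?S \<le> B * (2 * R / \<delta>) * (q - p)" by (simp only: mult.assoc)
  qed (rule inj D(1) sets_ud)+
  then show ?thesis by (rule that)
qed

section \<open>Long-time behaviour of the flow\<close>

theorem theorem4p4:
  fixes a :: "'n::finite \<Rightarrow> real^2"
    and D :: "(real^2) set"
    and ud :: "(real^2) measure"
    and \<rho> :: "real^2 \<Rightarrow> real"
    and \<alpha> :: real
    and g :: "real^'n \<Rightarrow> real"
    and gradg :: "real^'n \<Rightarrow> real^'n"
    and hessg :: "real^'n \<Rightarrow> real^'n^'n"
    and \<xi> :: "real \<Rightarrow> real^'n"
    and \<xi>0 :: "real^'n"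
  assumes "inj a"
    and "polytope D" and "interior D \<noteq> {}"
    and "continuous_on D \<rho>" and "\<forall>x\<in>D. 0 \<le> \<rho> x"
    and "ud = density (restrict_space lborel D) (\<lambda>x. ennreal (\<rho> x))"
    and "\<alpha> > 0"
    and "\<forall>u. GDERIV g u :> gradg u"
    and "\<forall>u. (gradg has_derivative (\<lambda>h. hessg u *v h)) (at u)"
    and "continuous_on UNIV hessg"
    and "\<forall>t\<ge>0. (\<xi> has_vector_derivative residual D ud a \<alpha> gradg (\<xi> t)) (at t within {0..})"
    and "\<xi> 0 = \<xi>0"
  shows "W_tilde D ud a \<alpha> gradg \<noteq> {}
       \<and> ((\<lambda>t. infdist (\<xi> t) (W_tilde D ud a \<alpha> gradg)) \<longlongrightarrow> 0) at_top
       \<and> ((\<forall>z\<in>{z. residual D ud a \<alpha> gradg z = 0}. z isolated_in {z. residual D ud a \<alpha> gradg z = 0})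
            \<longrightarrow> (\<exists>z. residual D ud a \<alpha> gradg z = 0 \<and> (\<xi> \<longlongrightarrow> z) at_top))"
proof -
  define A :: "real^'n" where "A = (1 / 2) *\<^sub>R (\<chi> i. (norm (a i))\<^sup>2)"
  define G where "G u = A \<bullet> u + (1 / \<alpha>) * g u" for u
  define G' where "G' u = A + (1 / \<alpha>) *\<^sub>R gradg u" for u
  have residual_eq: "residual D ud a \<alpha> gradg z = G' (u_tilde D ud a z) - z" for z
    by (simp add: residual_def G'_def A_def)
  obtain M where "semidiscrete a D ud M"
    using semidiscrete_density[OF assms(1) _ _ assms(4,6)] assms(2)
    by (metis polytope_imp_compact polytope_imp_convex)
  then interpret semidiscrete a D ud M .
  interpret gradient_relaxation U dual G G' "1 / (2 * CARD('n) * M)" \<xi>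
  proof
    show "0 < 1 / (2 * CARD('n) * M)" using M by simp
    show "GDERIV G u :> G' u" for u
    proof -
      have "(G has_derivative (\<lambda>h. A \<bullet> h + (1 / \<alpha>) * (h \<bullet> gradg u))) (at u)"
        unfolding G_def
        by (rule has_derivative_add[OF has_derivative_inner_right[OF has_derivative_ident]
            has_derivative_mult_right[OF assms(8)[rule_format, unfolded gderiv_def]]])
      moreover have "(\<lambda>h. A \<bullet> h + (1 / \<alpha>) * (h \<bullet> gradg u)) = (\<lambda>h. h \<bullet> G' u)"
        by (rule ext) (simp add: G'_def inner_add_right inner_commute[of A])
      ultimately show ?thesis by (simp only: gderiv_def)
    qed
    have "continuous_on UNIV gradg"
      by (intro continuous_at_imp_continuous_on ballI has_derivative_continuous[OF assms(9)[rule_format]])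
    then show "continuous_on UNIV G'" unfolding G'_def by (intro continuous_intros)
    show "(\<xi> has_vector_derivative G' (U (\<xi> t)) - \<xi> t) (at t within {0..})" if "t \<ge> 0" for t
      using assms(11) that by (simp add: residual_eq)
  qed (rule dual_subgradient U_cocoercive bounded_range_U)+
  have "{z. U (G' (U z)) = U z} \<subseteq> W_tilde D ud a \<alpha> gradg"
  proof
    fix z assume "z \<in> {z. U (G' (U z)) = U z}"
    then have fixed: "U (G' (U z)) = U z" by simp
    have "- (2 / \<alpha>) * fun_of_vec a (gradg (U z)) (a i) = (norm (a i))\<^sup>2 - 2 * G' (U z) $ i" for i
      using inj_a by (simp add: fun_of_vec_def G'_def A_def)
    then have "(\<lambda>x. - (2 / \<alpha>) * fun_of_vec a (gradg (U z)) x) \<in> potentials D ud a (U (G' (U z)))"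
      by (rule potential_of_cells)
    then show "z \<in> W_tilde D ud a \<alpha> gradg" by (simp add: W_tilde_def OC_def fixed)
  qed
  note W = infdist_tendsto_0[OF this]
  moreover have "\<exists>z. residual D ud a \<alpha> gradg z = 0 \<and> (\<xi> \<longlongrightarrow> z) at_top"
    if iso: "\<forall>z\<in>{z. residual D ud a \<alpha> gradg z = 0}. z isolated_in {z. residual D ud a \<alpha> gradg z = 0}"
  proof -
    have "z isolated_in {z. G' (U z) - z = 0}" if "G' (U z) - z = 0" for z
      using iso that by (simp add: residual_eq)
    then obtain z where "G' (U z) - z = 0" "(\<xi> \<longlongrightarrow> z) at_top"
      by (rule tendsto_isolated_equilibrium)
    then show ?thesis by (auto simp: residual_eq)
  qed
  ultimately show ?thesis by blast
qed

end
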